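(* Let $L>0$ be a bound on the Lipschitz constant of the gradient of the dual objective $J_d$ over a convex domain, and let the step-size be $\rho=1/L$. Then the alternating minimization algorithm (AMA) works as a proximal gradient algorithm on the dual problem: if $Y_1^k\in\mathbb{C}^{n\times n}$, $Y_2^k\in\mathbb{C}^{p\times p}$ are Hermitian with $\mathcal{A}^\dagger(Y_1^k,Y_2^k)\succ0$, then the AMA dual updates $$Y_1^{k+1}=Y_1^k+\rho\left(\mathcal{A}_1(X^{k+1})+Z^{k+1}\right),\qquad Y_2^{k+1}=Y_2^k+\rho\left(\mathcal{A}_2(X^{k+1})-G\right)$$ coincide with the proximal gradient updates $$Y_1^{k+1}=\operatorname*{argmin}_{Y_1}\;\left\langle\nabla_{Y_1}\!\left(-\log\det\mathcal{A}^\dagger(Y_1^k,Y_2^k)\right),Y_1\right\rangle+\mathcal{I}(Y_1)+\frac{L}{2}\|Y_1-Y_1^k\|_F^2,$$ $$Y_2^{k+1}=\operatorname*{argmin}_{Y_2}\;\left\langle\nabla_{Y_2}\!\left(-\log\det\mathcal{A}^\dagger(Y_1^k,Y_2^k)\right),Y_2\right\rangle+\langle G,Y_2\rangle+\frac{L}{2}\|Y_2-Y_2^k\|_F^2,$$ i.e. with the proximal gradient step of step-size $1/L$ for the dual problem written as the minimization of $-\log\det\mathcal{A}^\dagger(Y_1,Y_2)+\langle G,Y_2\rangle+\mathcal{I}(Y_1)$.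
   Context: Data: $A\in\mathbb{C}^{n\times n}$ Hurwitz, $C\in\mathbb{C}^{p\times n}$, a Hermitian matrix $G\in\mathbb{C}^{p\times p}$ with partially available entries, the symmetric 0/1 matrix $E$ with $E_{ij}=1$ if $G_{ij}$ is available and $0$ otherwise (unavailable entries of $G$ are set to zero), and $\gamma>0$. $\circ$ is elementwise multiplication. Define $$\mathcal{A}_1(X)=AX+XA^*,\quad \mathcal{A}_2(X)=(CXC^* )\circ E,\quad \mathcal{A}_1^\dagger(Y)=A^*Y+YA,\quad \mathcal{A}_2^\dagger(Y)=C^*(E\circ Y)C,$$ $$\mathcal{A}^\dagger(Y_1,Y_2)=\mathcal{A}_1^\dagger(Y_1)+\mathcal{A}_2^\dagger(Y_2),$$ where $\dagger$ denotes the adjoint for $\langle M_1,M_2\rangle=\operatorname{trace}(M_1^*M_2)$. All matrix variables are Hermitian. $\|\cdot\|_F$, $\|\cdot\|_2$, $\|\cdot\|_*$ are the Frobenius, spectral, and nuclear norms. The primal (covariance completion) problem is: minimize $-\log\det X+\gamma\|Z\|_*$ over $X,Z$ subject to $\mathcal{A}_1(X)+Z=0$ and $\mathcal{A}_2(X)-G=0$. The dual problem is: maximize $J_d(Y_1,Y_2)=\log\det\mathcal{A}^\dagger(Y_1,Y_2)-\langle G,Y_2\rangle+n$ subject to $\|Y_1\|_2\le\gamma$. $\mathcal{I}(Y_1)=0$ if $\|Y_1\|_2\le\gamma$ and $+\infty$ otherwise. The augmented Lagrangian is, for $\rho\ge0$, $$\mathcal{L}_\rho(X,Z;Y_1,Y_2)=-\log\det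 X+\gamma\|Z\|_*+\langle Y_1,\mathcal{A}_1(X)+Z\rangle+\langle Y_2,\mathcal{A}_2(X)-G\rangle+\tfrac{\rho}{2}\|\mathcal{A}_1(X)+Z\|_F^2+\tfrac{\rho}{2}\|\mathcal{A}_2(X)-G\|_F^2 .$$ An iteration of AMA with step-size $\rho>0$ consists of: $X^{k+1}=\operatorname{argmin}_X\mathcal{L}_0(X,Z^k;Y_1^k,Y_2^k)$ (over $X\succ0$), $Z^{k+1}=\operatorname{argmin}_Z\mathcal{L}_\rho(X^{k+1},Z;Y_1^k,Y_2^k)$, followed by the dual updates displayed in the claim. *)

theory Defs
  imports "HOL-Analysis.Analysis" "HOL-Computational_Algebra.Polynomial"
begin

section \<open>Complex matrices\<close>

definition ctranspose :: "complex^'n^'m \<Rightarrow> complex^'m^'n" where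
  "ctranspose M = (\<chi> i j. cnj (M $ j $ i))"

definition hermitian :: "complex^'n^'n \<Rightarrow> bool" where
  "hermitian M \<longleftrightarrow> ctranspose M = M"

definition posdef :: "complex^'n^'n \<Rightarrow> bool" where
  "posdef M \<longleftrightarrow> hermitian M \<and> (\<forall>v. v \<noteq> 0 \<longrightarrow> Re (\<Sum>i\<in>UNIV. cnj (v $ i) * (M *v v) $ i) > 0)"

definition hurwitz :: "complex^'n^'n \<Rightarrow> bool" where
  "hurwitz M \<longleftrightarrow> (\<forall>l v. v \<noteq> 0 \<and> M *v v = l *s v \<longrightarrow> Re l < 0)"

definition hadamard :: "complex^'n^'m \<Rightarrow> complex^'n^'m \<Rightarrow> complex^'n^'m" where
  "hadamard M N = (\<chi> i j. M $ i $ j * N $ i $ j)"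

text \<open>Only used at (or, inside derivatives, near) positive definite matrices, whose determinant is
  a positive real number.\<close>

definition log_det :: "complex^'n^'n \<Rightarrow> real" where
  "log_det M = ln (Re (det M))"

text \<open>The trace inner product and the Frobenius norm are the library's \<^term>\<open>M \<bullet> N\<close> and
  \<^term>\<open>norm M\<close>, as the following facts confirm. On Hermitian matrices the trace is real, so that
  taking the real part loses nothing.\<close>

lemma inner_eq_Re_trace:
  fixes M N :: "complex^'n^'m"
  shows "M \<bullet> N = Re (trace (ctranspose M ** N))"
proof -
  have "Re (trace (ctranspose M ** N)) = (\<Sum>i\<in>UNIV. \<Sum>k\<in>UNIV. M $ k $ i \<bullet> N $ k $ i)"
    by (simp add: trace_def ctranspose_def matrix_matrix_mult_def inner_complex_def)
  also have "\<dots> = M \<bullet> N"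
    unfolding inner_vec_def by (rule sum.swap)
  finally show ?thesis by simp
qed

lemma hermitian_trace_eq_inner:
  fixes M N :: "complex^'n^'n"
  assumes "hermitian M" "hermitian N"
  shows "trace (ctranspose M ** N) = of_real (M \<bullet> N)"
proof -
  have h: "cnj (M $ j $ i) = M $ i $ j" "cnj (N $ j $ i) = N $ i $ j" for i j
    using assms by (auto simp: hermitian_def ctranspose_def vec_eq_iff)
  have "cnj (trace (ctranspose M ** N)) = (\<Sum>i\<in>UNIV. \<Sum>k\<in>UNIV. M $ k $ i * N $ i $ k)"
    by (simp add: trace_def ctranspose_def matrix_matrix_mult_def h)
  also have "\<dots> = (\<Sum>k\<in>UNIV. \<Sum>i\<in>UNIV. M $ k $ i * N $ i $ k)"
    by (rule sum.swap)
  also have "\<dots> = trace (ctranspose M ** N)"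
    by (simp add: trace_def ctranspose_def matrix_matrix_mult_def h)
  finally have "trace (ctranspose M ** N) \<in> \<real>"
    by (simp add: Reals_cnj_iff)
  then show ?thesis
    by (simp add: inner_eq_Re_trace)
qed

lemma norm_eq_Frobenius:
  fixes M :: "complex^'n^'m"
  shows "norm M = sqrt (\<Sum>i\<in>UNIV. \<Sum>j\<in>UNIV. (cmod (M $ i $ j))\<^sup>2)"
  by (simp add: norm_vec_def L2_set_def sum_nonneg)

text \<open>The operator norm induced by the Euclidean norm.\<close>

definition spectral_norm :: "complex^'n^'m \<Rightarrow> real" where
  "spectral_norm M = onorm ((*v) M)"

definition characteristic_poly :: "complex^'n^'n \<Rightarrow> complex poly" where
  "characteristic_poly M = det (\<chi> i j. (if i = j then [:0, 1:] else 0) - [:M $ i $ j:])"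

text \<open>The sum of the singular values, that is, of the square roots of the eigenvalues of
  \<^term>\<open>ctranspose M ** M\<close>, counted with algebraic multiplicity.\<close>

definition nuclear_norm :: "complex^'n^'m \<Rightarrow> real" where
  "nuclear_norm M =
     (let q = characteristic_poly (ctranspose M ** M)
      in \<Sum>x | poly q x = 0. real (order x q) * sqrt (Re x))"


section \<open>Minimizers and proximal gradient steps\<close>

text \<open>An equation with an argmin asserts that a minimizer exists and is unique.\<close>

definition is_unique_arg_min :: "('a \<Rightarrow> 'b::ord) \<Rightarrow> ('a \<Rightarrow> bool) \<Rightarrow> 'a \<Rightarrow> bool" where
  "is_unique_arg_min f P x \<longleftrightarrow> is_arg_min f P x \<and> (\<forall>y. is_arg_min f P y \<longrightarrow> y = x)"

text \<open>The gradient of a function on a linear subspace \<open>S\<close> (here the Hermitian matrices, or pairs of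
  these), with respect to the inner product of the ambient space.\<close>

definition gradient_on :: "'a::real_inner set \<Rightarrow> ('a \<Rightarrow> real) \<Rightarrow> 'a \<Rightarrow> 'a" where
  "gradient_on S f x = (THE g. g \<in> S \<and> (f has_derivative (\<lambda>h. g \<bullet> h)) (at x within S))"

text \<open>\<open>y\<close> is the result of a proximal gradient step of step-size \<open>1 / L\<close> from \<open>x\<close> for the
  minimization of \<open>f + g\<close> over \<open>S\<close>, with smooth part \<open>f\<close>.\<close>

definition prox_grad_step ::
  "'a::real_inner set \<Rightarrow> ('a \<Rightarrow> real) \<Rightarrow> ('a \<Rightarrow> ereal) \<Rightarrow> real \<Rightarrow> 'a \<Rightarrow> 'a \<Rightarrow> bool" where
  "prox_grad_step S f g L x y \<longleftrightarrow>
     is_unique_arg_min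
       (\<lambda>v. ereal (gradient_on S f x \<bullet> v) + g v + ereal (L / 2 * (norm (v - x))\<^sup>2))
       (\<lambda>v. v \<in> S) y"


section \<open>Covariance completion\<close>

definition A1 :: "complex^'n^'n \<Rightarrow> complex^'n^'n \<Rightarrow> complex^'n^'n" where
  "A1 A X = A ** X + X ** ctranspose A"

definition A2 :: "complex^'n^'p \<Rightarrow> complex^'p^'p \<Rightarrow> complex^'n^'n \<Rightarrow> complex^'p^'p" where
  "A2 C E X = hadamard (C ** X ** ctranspose C) E"

definition A1_adj :: "complex^'n^'n \<Rightarrow> complex^'n^'n \<Rightarrow> complex^'n^'n" where
  "A1_adj A Y = ctranspose A ** Y + Y ** A"

definition A2_adj :: "complex^'n^'p \<Rightarrow> complex^'p^'p \<Rightarrow> complex^'p^'p \<Rightarrow> complex^'n^'n" where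
  "A2_adj C E Y = ctranspose C ** hadamard E Y ** C"

definition A_adj ::
  "complex^'n^'n \<Rightarrow> complex^'n^'p \<Rightarrow> complex^'p^'p \<Rightarrow>
   complex^'n^'n \<Rightarrow> complex^'p^'p \<Rightarrow> complex^'n^'n" where
  "A_adj A C E Y1 Y2 = A1_adj A Y1 + A2_adj C E Y2"

definition dual_objective ::
  "complex^'n^'n \<Rightarrow> complex^'n^'p \<Rightarrow> complex^'p^'p \<Rightarrow> complex^'p^'p \<Rightarrow>
   complex^'n^'n \<Rightarrow> complex^'p^'p \<Rightarrow> real" where
  "dual_objective A C E G Y1 Y2 = log_det (A_adj A C E Y1 Y2) - G \<bullet> Y2 + real CARD('n)"

definition spectral_ball_indicator :: "real \<Rightarrow> complex^'n^'n \<Rightarrow> ereal" where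
  "spectral_ball_indicator \<gamma> Y1 = (if spectral_norm Y1 \<le> \<gamma> then 0 else \<infinity>)"

definition aug_lagrangian ::
  "complex^'n^'n \<Rightarrow> complex^'n^'p \<Rightarrow> complex^'p^'p \<Rightarrow> complex^'p^'p \<Rightarrow> real \<Rightarrow> real \<Rightarrow>
   complex^'n^'n \<Rightarrow> complex^'n^'n \<Rightarrow> complex^'n^'n \<Rightarrow> complex^'p^'p \<Rightarrow> real" where
  "aug_lagrangian A C E G \<gamma> \<rho> X Z Y1 Y2 =
     - log_det X + \<gamma> * nuclear_norm Z
     + Y1 \<bullet> (A1 A X + Z) + Y2 \<bullet> (A2 C E X - G)
     + \<rho> / 2 * (norm (A1 A X + Z))\<^sup>2 + \<rho> / 2 * (norm (A2 C E X - G))\<^sup>2"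

text \<open>One iteration of AMA from \<open>(Z, Y1, Y2)\<close> to \<open>(X', Z', Y1', Y2')\<close>; the previous \<open>X\<close> plays no
  role.\<close>

definition ama_step ::
  "complex^'n^'n \<Rightarrow> complex^'n^'p \<Rightarrow> complex^'p^'p \<Rightarrow> complex^'p^'p \<Rightarrow> real \<Rightarrow> real \<Rightarrow>
   complex^'n^'n \<Rightarrow> complex^'n^'n \<Rightarrow> complex^'p^'p \<Rightarrow>
   complex^'n^'n \<Rightarrow> complex^'n^'n \<Rightarrow> complex^'n^'n \<Rightarrow> complex^'p^'p \<Rightarrow> bool" where
  "ama_step A C E G \<gamma> \<rho> Z Y1 Y2 X' Z' Y1' Y2' \<longleftrightarrow>
     is_unique_arg_min (\<lambda>X. aug_lagrangian A C E G \<gamma> 0 X Z Y1 Y2) posdef X' \<and>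
     is_unique_arg_min (\<lambda>W. aug_lagrangian A C E G \<gamma> \<rho> X' W Y1 Y2) hermitian Z' \<and>
     Y1' = Y1 + \<rho> *\<^sub>R (A1 A X' + Z') \<and>
     Y2' = Y2 + \<rho> *\<^sub>R (A2 C E X' - G)"

end

theory Submission
  imports Defs
begin

text \<open>
  Write \<open>W\<close> for the matrix \<open>A_adj A C E Y1 Y2\<close> and \<open>X\<close> for its inverse. The
  log-determinant enters both algorithms only through \<open>X\<close>, and from there on both compute the same
  pair of matrices.

  The bridge is that \<open>log_det\<close> is strictly concave on positive definite matrices with gradient the
  inverse (\<open>log_det_tangent\<close>). By adjointness the Lagrangian at \<open>\<rho> = 0\<close> is
  \<open>- log_det X' + W \<bullet> X'\<close> up to a constant, so the AMA step for \<open>X\<close> returns exactly \<open>X\<close>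
  (\<open>log_det_minimizer\<close>); and the gradient of the smooth part of the dual at \<open>(Y1, Y2)\<close> is the pair
  \<open>(- A1 A X, - A2 C E X)\<close> (\<open>gradient_neg_log_det\<close>). For \<open>Y2\<close> this already suffices: the proximal
  problem is an unconstrained quadratic with minimizer \<open>Y2 + \<rho> *\<^sub>R (A2 C E X - G)\<close>.

  For \<open>Y1\<close>, put \<open>V = Y1 + \<rho> *\<^sub>R A1 A X\<close>. The proximal step projects \<open>V\<close> onto the spectral ball of
  radius \<open>\<gamma>\<close>. The AMA step for \<open>Z\<close> is soft thresholding, the proximal map of the nuclear norm,
  which is the norm dual to the spectral norm. Moreau's decomposition relates the two:
  \<open>V = P + T\<close> with \<open>P\<close> in the ball and \<open>P \<bullet> T = \<gamma> * nuclear_norm T\<close>, obtained by clipping the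
  eigenvalues of \<open>V\<close> (\<open>spectral_ball_decomposition\<close>). The duality inequality
  \<open>abs_inner_le_spectral_nuclear\<close> then shows that \<open>P\<close> is the projection and that the minimizing \<open>Z\<close>
  is \<open>- T / \<rho>\<close> (\<open>nuclear_norm_prox\<close>), so that AMA also moves \<open>Y1\<close> to \<open>V - T = P\<close>.

  All statements about eigenvalues are read off a unitary diagonalization \<open>udiag U d\<close> of a
  Hermitian matrix, whose existence is \<open>hermitian_spectral\<close>.
\<close>

section \<open>Unique minimizers, gradients and proximal steps\<close>

lemma is_unique_arg_minI:
  fixes f :: "'a \<Rightarrow> 'b::linorder"
  assumes "P x" "\<And>y. P y \<Longrightarrow> y \<noteq> x \<Longrightarrow> f x < f y"
  shows "is_unique_arg_min f P x"
  unfolding is_unique_arg_min_def is_arg_min_linorder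
  using assms by (metis less_imp_le not_less order_refl)

lemma is_unique_arg_min_iff:
  assumes "is_unique_arg_min f P x"
  shows "is_unique_arg_min f P y \<longleftrightarrow> y = x"
  using assms by (auto simp: is_unique_arg_min_def)

lemma diff_norm_square:
  fixes v w x :: "'a::real_inner"
  shows "(norm (v - x))\<^sup>2 = (norm (w - x))\<^sup>2 + 2 * ((w - x) \<bullet> (v - w)) + (norm (v - w))\<^sup>2"
  unfolding power2_norm_eq_inner by (simp add: inner_diff_left inner_diff_right inner_commute)

text \<open>The hypothesis says that the residual \<open>L *\<^sub>R (x - y) - gradient\<close> is a subgradient of \<open>g\<close> at
  \<open>y\<close> relative to \<open>S\<close>. The quadratic term then leaves a surplus \<open>L / 2 * (norm (v - y))\<^sup>2\<close> at every
  competitor \<open>v\<close>, which makes the minimizer unique.\<close>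

lemma prox_grad_stepI:
  assumes "L > 0" "y \<in> S" "g y = ereal c"
    and "\<And>v. v \<in> S \<Longrightarrow> ereal (c + (L *\<^sub>R (x - y) - gradient_on S f x) \<bullet> (v - y)) \<le> g v"
  shows "prox_grad_step S f g L x y"
  unfolding prox_grad_step_def
proof (rule is_unique_arg_minI)
  fix v assume v: "v \<in> S" "v \<noteq> y"
  define b where "b = gradient_on S f x"
  define r where "r = c + (L *\<^sub>R (x - y) - b) \<bullet> (v - y)"
  have "0 < L / 2 * (norm (v - y))\<^sup>2" using assms(1) v(2) by simp
  moreover have "b \<bullet> v + r + L / 2 * (norm (v - x))\<^sup>2
      = b \<bullet> y + c + L / 2 * (norm (y - x))\<^sup>2 + L / 2 * (norm (v - y))\<^sup>2"
    unfolding diff_norm_square[of v x y] r_def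
    by (simp add: algebra_simps inner_add_left inner_diff_left inner_diff_right)
  ultimately have "ereal (b \<bullet> y) + g y + ereal (L / 2 * (norm (y - x))\<^sup>2)
      < ereal (b \<bullet> v) + ereal r + ereal (L / 2 * (norm (v - x))\<^sup>2)"
    by (simp add: assms(3))
  also have "\<dots> \<le> ereal (b \<bullet> v) + g v + ereal (L / 2 * (norm (v - x))\<^sup>2)"
    using assms(4)[OF v(1)] unfolding r_def b_def by (intro add_mono) auto
  finally show "ereal (gradient_on S f x \<bullet> y) + g y + ereal (L / 2 * (norm (y - x))\<^sup>2)
      < ereal (gradient_on S f x \<bullet> v) + g v + ereal (L / 2 * (norm (v - x))\<^sup>2)"
    by (simp add: b_def)
qed (fact assms(2))

text \<open>Difference quotients within a subspace only see the derivative on that subspace.\<close>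

lemma has_derivative_within_subspace:
  assumes f: "(f has_derivative f') (at x within S)" and S: "subspace S" "x \<in> S"
    and g: "bounded_linear g" "\<And>h. h \<in> S \<Longrightarrow> g h = f' h"
  shows "(f has_derivative g) (at x within S)"
proof -
  have lim: "((\<lambda>y. (1 / norm (y - x)) *\<^sub>R (f y - (f x + f' (y - x)))) \<longlongrightarrow> 0) (at x within S)"
    using f by (simp add: has_derivative_within)
  have "\<forall>\<^sub>F y in at x within S. (1 / norm (y - x)) *\<^sub>R (f y - (f x + f' (y - x)))
      = (1 / norm (y - x)) *\<^sub>R (f y - (f x + g (y - x)))"
    unfolding eventually_at_filter using S g(2) by (intro always_eventually) (auto simp: subspace_diff)
  from Lim_transform_eventually[OF lim this] show ?thesis
    using g(1) by (simp add: has_derivative_within)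
qed

text \<open>Two candidate gradients in \<open>S\<close> differ by a vector of \<open>S\<close>; the derivative along the line in this
  very direction shows that it is orthogonal to itself.\<close>

lemma gradient_on_eqI:
  assumes S: "subspace S" "x \<in> S" "g \<in> S"
    and g: "(f has_derivative (\<lambda>h. g \<bullet> h)) (at x within S)"
  shows "gradient_on S f x = g"
  unfolding gradient_on_def
proof (rule the_equality)
  show "g \<in> S \<and> (f has_derivative (\<lambda>h. g \<bullet> h)) (at x within S)" using assms by simp
  fix g' assume g': "g' \<in> S \<and> (f has_derivative (\<lambda>h. g' \<bullet> h)) (at x within S)"
  define h where "h = g' - g"
  have h: "h \<in> S" using S g' by (simp add: h_def subspace_diff)
  have line: "((\<lambda>t. x + t *\<^sub>R h) has_derivative (\<lambda>t. t *\<^sub>R h)) (at 0)"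
    by (auto intro!: derivative_eq_intros)
  have "range (\<lambda>t. x + t *\<^sub>R h) \<subseteq> S"
    using S h by (auto intro: subspace_add subspace_scale)
  then have "((\<lambda>t. f (x + t *\<^sub>R h)) has_derivative (\<lambda>t. k \<bullet> (t *\<^sub>R h))) (at 0)"
    if "(f has_derivative (\<lambda>h. k \<bullet> h)) (at x within S)" for k
    using has_derivative_in_compose[OF line, of f "\<lambda>h. k \<bullet> h"] has_derivative_subset[OF that]
    by simp
  from has_derivative_unique[OF this this, OF conjunct2[OF g'] g] have "g' \<bullet> h = g \<bullet> h"
    by (metis scaleR_one)
  then have "h \<bullet> h = 0" by (simp add: h_def inner_diff_left)
  then show "g' = g" by (simp add: h_def)
qed

section \<open>The complex inner product and the conjugate transpose\<close>

definition cdot :: "complex^'n \<Rightarrow> complex^'n \<Rightarrow> complex" where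
  "cdot v w = (\<Sum>i\<in>UNIV. cnj (v $ i) * w $ i)"

lemma Re_cdot: "Re (cdot v w) = v \<bullet> w"
  by (simp add: cdot_def inner_vec_def inner_complex_def)

lemma cdot_self: "cdot v v = of_real ((norm v)\<^sup>2)"
proof -
  have "cdot v v = of_real (\<Sum>i\<in>UNIV. (cmod (v $ i))\<^sup>2)"
    unfolding cdot_def of_real_sum complex_norm_square by (simp only: mult.commute)
  then show ?thesis by (simp add: norm_vec_def L2_set_def sum_nonneg)
qed

lemma cdot_add_right: "cdot u (v + w) = cdot u v + cdot u w"
  by (simp add: cdot_def algebra_simps sum.distrib)

lemma cdot_diff_right: "cdot u (v - w) = cdot u v - cdot u w"
  by (simp add: cdot_def algebra_simps sum_subtractf)

lemma cdot_scaleR_right: "cdot u (c *\<^sub>R v) = of_real c * cdot u v"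
  by (simp add: cdot_def scaleR_conv_of_real[where 'a = complex] sum_distrib_left mult_ac)

lemma cdot_scaleR_left: "cdot (c *\<^sub>R u) v = of_real c * cdot u v"
  by (simp add: cdot_def scaleR_conv_of_real[where 'a = complex] sum_distrib_left mult_ac)

lemma cdot_commute: "cdot v w = cnj (cdot w v)"
  by (simp add: cdot_def mult.commute)

lemma cdot_norm_le: "cmod (cdot v w) \<le> norm v * norm w"
proof -
  have "cmod (cdot v w) \<le> (\<Sum>i\<in>UNIV. \<bar>norm (v $ i)\<bar> * \<bar>norm (w $ i)\<bar>)"
    unfolding cdot_def by (rule sum_norm_le) (simp add: norm_mult)
  also have "\<dots> \<le> norm v * norm w"
    unfolding norm_vec_def by (rule L2_set_mult_ineq)
  finally show ?thesis .
qed

lemma cdot_matrix_left: "cdot v (M *v w) = cdot (ctranspose M *v v) w"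
proof -
  have "cdot v (M *v w) = (\<Sum>i\<in>UNIV. \<Sum>j\<in>UNIV. cnj (v $ i) * M $ i $ j * w $ j)"
    by (simp add: cdot_def matrix_vector_mult_def sum_distrib_left mult.assoc)
  also have "\<dots> = (\<Sum>j\<in>UNIV. \<Sum>i\<in>UNIV. cnj (v $ i) * M $ i $ j * w $ j)"
    by (rule sum.swap)
  also have "\<dots> = cdot (ctranspose M *v v) w"
    by (simp add: cdot_def matrix_vector_mult_def ctranspose_def sum_distrib_right sum_distrib_left mult_ac)
  finally show ?thesis .
qed

lemma inner_matrix_left: "v \<bullet> (M *v w) = (ctranspose M *v v) \<bullet> w"
  by (metis Re_cdot cdot_matrix_left)

lemma ctranspose_ctranspose [simp]: "ctranspose (ctranspose M) = M"
  by (simp add: ctranspose_def vec_eq_iff)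

lemma ctranspose_mul: "ctranspose (M ** N) = ctranspose N ** ctranspose M"
  by (simp add: ctranspose_def matrix_matrix_mult_def vec_eq_iff mult.commute)

lemma ctranspose_add: "ctranspose (M + N) = ctranspose M + ctranspose N"
  by (simp add: ctranspose_def vec_eq_iff)

lemma ctranspose_diff: "ctranspose (M - N) = ctranspose M - ctranspose N"
  by (simp add: ctranspose_def vec_eq_iff)

lemma ctranspose_scaleR: "ctranspose (c *\<^sub>R M) = c *\<^sub>R ctranspose M"
  by (simp add: ctranspose_def vec_eq_iff)

lemma ctranspose_zero [simp]: "ctranspose 0 = 0"
  by (simp add: ctranspose_def vec_eq_iff)

lemma matrix_vector_scaleR: "M *v (c *\<^sub>R v) = c *\<^sub>R (M *v (v :: complex^'n))"
  by (simp add: matrix_vector_mult_def vec_eq_iff scaleR_sum_right)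

lemma linear_matrix_vector: "linear ((*v) (M :: complex^'n^'m))"
  by (rule linearI) (simp_all add: matrix_vector_right_distrib matrix_vector_scaleR)

lemma bounded_linear_matrix_vector: "bounded_linear ((*v) (M :: complex^'n^'m))"
  by (simp add: linear_matrix_vector linear_conv_bounded_linear[symmetric])

lemma subspace_hermitian: "subspace (Collect hermitian)"
  by (rule subspaceI) (auto simp: hermitian_def ctranspose_add ctranspose_scaleR)

lemma posdef_iff_inner:
  "posdef M \<longleftrightarrow> hermitian M \<and> (\<forall>v. v \<noteq> 0 \<longrightarrow> v \<bullet> (M *v v) > 0)"
  by (simp add: posdef_def flip: Re_cdot cdot_def)

section \<open>Unitary diagonalization of Hermitian matrices\<close>

text \<open>Conjugating the vectors into the rows of a square matrix, with a zero row at the spare index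
  \<open>a\<close>, gives a singular matrix; a kernel vector is what is wanted.\<close>

lemma exists_cdot_orthogonal:
  fixes u :: "'n::finite \<Rightarrow> complex^'n"
  assumes "a \<notin> I"
  shows "\<exists>v. v \<noteq> 0 \<and> (\<forall>i\<in>I. cdot (u i) v = 0)"
proof -
  define N :: "complex^'n^'n" where "N = (\<chi> i. if i = a then 0 else (\<chi> j. cnj (u i $ j)))"
  have "det N = 0"
    by (rule det_zero_row(2)[of a]) (simp add: N_def row_def vec_eq_iff)
  then have "\<not> (\<exists>B. B ** N = mat 1)"
    by (metis invertible_det_nz invertible_left_inverse)
  then obtain v where v: "v \<noteq> 0" "N *v v = 0"
    by (auto simp: matrix_left_invertible_ker)
  have "cdot (u i) v = (N *v v) $ i" if "i \<in> I" for i
    using that assms by (auto simp: cdot_def N_def matrix_vector_mult_def)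
  with v show ?thesis by auto
qed

text \<open>The orthogonal complement of the given eigenvectors is invariant under \<open>M\<close>, and a maximizer \<open>v\<close>
  of the Rayleigh quotient on it is an eigenvector: the residual \<open>M *v v - l *\<^sub>R v\<close> lies in the
  complement too, and to first order moving along it would increase the quotient.\<close>

lemma exists_orthogonal_eigenvector:
  fixes M :: "complex^'n^'n" and u :: "'n \<Rightarrow> complex^'n"
  assumes M: "hermitian M" and k: "k \<notin> I"
    and eig: "\<And>i. i \<in> I \<Longrightarrow> M *v u i = d i *\<^sub>R u i"
  shows "\<exists>v l. norm v = 1 \<and> M *v v = l *\<^sub>R v \<and> (\<forall>i\<in>I. cdot (u i) v = 0)"
proof -
  define S where "S = {v. \<forall>i\<in>I. cdot (u i) v = 0}"
  have Mt: "ctranspose M = M" using M by (simp add: hermitian_def)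
  have S_inv: "M *v v \<in> S" if "v \<in> S" for v
    using that by (auto simp: S_def cdot_matrix_left Mt eig cdot_scaleR_left)
  have S_sub: "v + t *\<^sub>R w \<in> S" "v - t *\<^sub>R w \<in> S" "t *\<^sub>R v \<in> S" if "v \<in> S" "w \<in> S" for v w t
    using that by (auto simp: S_def cdot_add_right cdot_diff_right cdot_scaleR_right)
  have "continuous_on UNIV (cdot (u i))" for i
    unfolding cdot_def by (intro continuous_intros)
  then have "closed {v. cdot (u i) v = 0}" for i
    by (intro closed_Collect_eq continuous_on_const)
  moreover have "S = (\<Inter>i\<in>I. {v. cdot (u i) v = 0})" by (auto simp: S_def)
  ultimately have "closed S" by (simp add: closed_INT)
  then have "compact (S \<inter> sphere 0 1)"
    by (intro closed_Int_compact) auto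
  moreover have "S \<inter> sphere 0 1 \<noteq> {}"
  proof -
    obtain v where "v \<noteq> 0" "v \<in> S"
      using exists_cdot_orthogonal[OF k, of u] by (auto simp: S_def)
    then have "(1 / norm v) *\<^sub>R v \<in> S \<inter> sphere 0 1"
      using S_sub by (simp add: dist_norm)
    then show ?thesis by blast
  qed
  moreover have "continuous_on (S \<inter> sphere 0 1) (\<lambda>v. v \<bullet> (M *v v))"
    by (intro continuous_intros linear_continuous_on bounded_linear_matrix_vector)
  ultimately obtain v where v: "v \<in> S" "norm v = 1"
    and max: "\<And>w. w \<in> S \<Longrightarrow> norm w = 1 \<Longrightarrow> w \<bullet> (M *v w) \<le> v \<bullet> (M *v v)"
    using continuous_attains_sup[of "S \<inter> sphere 0 1" "\<lambda>v. v \<bullet> (M *v v)"]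
    by (fastforce simp: dist_norm)
  define l where "l = v \<bullet> (M *v v)"
  have le: "w \<bullet> (M *v w) \<le> l * (w \<bullet> w)" if "w \<in> S" for w
  proof (cases "w = 0")
    case False
    let ?w = "(1 / norm w) *\<^sub>R w"
    have "?w \<bullet> (M *v ?w) \<le> l"
      unfolding l_def using that False by (intro max S_sub) auto
    then have "w \<bullet> (M *v w) / (norm w)\<^sup>2 \<le> l"
      by (simp add: matrix_vector_scaleR power2_eq_square)
    then show ?thesis using False by (simp add: field_simps power2_norm_eq_inner)
  qed simp
  define y where "y = M *v v - l *\<^sub>R v"
  have y: "y \<in> S" unfolding y_def by (intro S_sub S_inv v)
  define a where "a = y \<bullet> y"
  define B where "B = y \<bullet> (M *v y) - l * (y \<bullet> y)"
  have sym: "v \<bullet> (M *v y) = y \<bullet> (M *v v)"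
    by (subst inner_matrix_left) (simp add: Mt inner_commute)
  have vv: "v \<bullet> v = 1" using v(2) by (simp add: norm_eq_1)
  have a: "a = y \<bullet> (M *v v) - l * (y \<bullet> v)"
    unfolding a_def by (subst (2) y_def) (simp add: inner_diff_right)
  \<comment> \<open>Maximality of \<open>v\<close> along the line through \<open>v\<close> in the direction of the residual \<open>y\<close>.\<close>
  have t: "2 * t * a + t\<^sup>2 * B \<le> 0" for t
  proof -
    have "(v + t *\<^sub>R y) \<bullet> (M *v (v + t *\<^sub>R y))
        = l + 2 * t * (y \<bullet> (M *v v)) + t\<^sup>2 * (y \<bullet> (M *v y))"
      by (simp add: matrix_vector_right_distrib matrix_vector_scaleR inner_add_left inner_add_right
          sym l_def power2_eq_square algebra_simps)
    moreover have "(v + t *\<^sub>R y) \<bullet> (v + t *\<^sub>R y) = 1 + 2 * t * (y \<bullet> v) + t\<^sup>2 * (y \<bullet> y)"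
      by (simp add: inner_add_left inner_add_right vv inner_commute power2_eq_square)
    ultimately have "l + 2 * t * (y \<bullet> (M *v v)) + t\<^sup>2 * (y \<bullet> (M *v y))
        \<le> l * (1 + 2 * t * (y \<bullet> v) + t\<^sup>2 * (y \<bullet> y))"
      using le[OF S_sub(1)[OF v(1) y], of t] by simp
    then show ?thesis
      unfolding a B_def by (simp add: algebra_simps)
  qed
  have "a = 0"
  proof (rule ccontr)
    assume "a \<noteq> 0"
    then have "a > 0" by (simp add: a_def)
    \<comment> \<open>The linear term in \<open>t\<close> dominates for small \<open>t > 0\<close>.\<close>
    define b where "b = \<bar>B\<bar> + 1"
    have b: "b > 0" "2 * b + B > 0" by (auto simp: b_def)
    have "2 * (a / b) * a + (a / b)\<^sup>2 * B = a\<^sup>2 / b\<^sup>2 * (2 * b + B)"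
      using b(1) by (simp add: field_simps power2_eq_square)
    moreover have "\<dots> > 0"
      using \<open>a > 0\<close> b by simp
    ultimately show False using t[of "a / b"] by linarith
  qed
  then have "M *v v = l *\<^sub>R v" by (simp add: a_def y_def)
  then show ?thesis using v by (auto simp: S_def)
qed

definition unitary :: "complex^'n^'n \<Rightarrow> bool" where
  "unitary U \<longleftrightarrow> ctranspose U ** U = mat 1"

definition cdiag :: "('n \<Rightarrow> real) \<Rightarrow> complex^'n^'n" where
  "cdiag d = (\<chi> i j. if i = j then of_real (d i) else 0)"

definition udiag :: "complex^'n^'n \<Rightarrow> ('n \<Rightarrow> real) \<Rightarrow> complex^'n^'n" where
  "udiag U d = U ** cdiag d ** ctranspose U"

lemma unitary_ctranspose:
  assumes "unitary U"
  shows "ctranspose U ** U = mat 1" "U ** ctranspose U = mat 1"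
  using assms matrix_left_right_inverse by (auto simp: unitary_def)

text \<open>Orthonormal eigenvectors are collected by induction on subsets of the index type itself, so that
  in the end they are the columns of a square matrix.\<close>

theorem hermitian_spectral:
  fixes M :: "complex^'n^'n"
  assumes M: "hermitian M"
  obtains U d where "unitary U" "M = udiag U d"
proof -
  have "\<exists>u d. \<forall>i\<in>I. M *v u i = d i *\<^sub>R u i \<and>
      (\<forall>j\<in>I. cdot (u i) (u j) = (if i = j then 1 else 0))" for I :: "'n set"
    using finite[of I]
  proof (induction I rule: finite_induct)
    case (insert a I)
    then obtain u :: "'n \<Rightarrow> complex^'n" and d where u: "\<And>i. i \<in> I \<Longrightarrow> M *v u i = d i *\<^sub>R u i"
      "\<And>i j. i \<in> I \<Longrightarrow> j \<in> I \<Longrightarrow> cdot (u i) (u j) = (if i = j then 1 else 0)"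
      by metis
    obtain v l where v: "norm v = 1" "M *v v = l *\<^sub>R v" "\<And>i. i \<in> I \<Longrightarrow> cdot (u i) v = 0"
      using exists_orthogonal_eigenvector[of M a I u d] M \<open>a \<notin> I\<close> u(1) by blast
    have "cdot v (u i) = 0" if "i \<in> I" for i
      using v(3)[OF that] by (subst cdot_commute) simp
    moreover have "cdot v v = 1" using v(1) by (simp add: cdot_self)
    ultimately show ?case
      using insert.hyps u v
      by (intro exI[of _ "u(a := v)"] exI[of _ "d(a := l)"]) auto
  qed auto
  from this[of UNIV] obtain u :: "'n \<Rightarrow> complex^'n" and d where u: "\<And>i. M *v u i = d i *\<^sub>R u i"
    "\<And>i j. cdot (u i) (u j) = (if i = j then 1 else 0)" by auto
  define U :: "complex^'n^'n" where "U = (\<chi> i j. u j $ i)"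
  have U: "unitary U"
    unfolding unitary_def using u(2)
    by (simp add: vec_eq_iff matrix_matrix_mult_def ctranspose_def U_def mat_def cdot_def)
  have "(M ** U) $ i $ j = (U ** cdiag d) $ i $ j" for i j
  proof -
    have "(M ** U) $ i $ j = (M *v u j) $ i"
      by (simp add: matrix_matrix_mult_def matrix_vector_mult_def U_def)
    also have "\<dots> = (U ** cdiag d) $ i $ j"
      by (simp add: u matrix_matrix_mult_def U_def cdiag_def if_distrib[of "(*) _"]
          scaleR_conv_of_real[where 'a = complex] cong: if_cong)
    finally show ?thesis .
  qed
  then have "M ** U = U ** cdiag d" by (simp add: vec_eq_iff)
  then have "M = udiag U d"
    unfolding udiag_def by (metis U matrix_mul_assoc matrix_mul_rid unitary_ctranspose(2))
  with U show thesis by (rule that)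
qed

lemma ctranspose_cdiag [simp]: "ctranspose (cdiag d) = cdiag d"
  by (auto simp: ctranspose_def cdiag_def vec_eq_iff)

lemma cdiag_one: "cdiag (\<lambda>_. 1) = mat 1"
  by (simp add: cdiag_def mat_def vec_eq_iff)

lemma cdiag_mul_left: "(cdiag d ** M) $ i $ j = of_real (d i) * M $ i $ j"
  by (simp add: matrix_matrix_mult_def cdiag_def if_distrib[of "\<lambda>c. c * _"] cong: if_cong)

lemma cdiag_mul_right: "(M ** cdiag d) $ i $ j = M $ i $ j * of_real (d j)"
  by (simp add: matrix_matrix_mult_def cdiag_def if_distrib[of "(*) _"] cong: if_cong)

lemma udiag_nth: "udiag U d $ i $ j = (\<Sum>k\<in>UNIV. of_real (d k) * (U $ i $ k * cnj (U $ j $ k)))"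
  unfolding udiag_def matrix_matrix_mult_def[of "U ** cdiag d"]
  by (simp add: cdiag_mul_right ctranspose_def mult_ac)

lemma udiag_diff: "udiag U d - udiag U e = udiag U (\<lambda>i. d i - e i)"
  by (simp add: vec_eq_iff udiag_nth sum_subtractf left_diff_distrib)

lemma udiag_scaleR: "c *\<^sub>R udiag U d = udiag U (\<lambda>i. c * d i)"
  by (simp add: vec_eq_iff udiag_nth scaleR_sum_right scaleR_conv_of_real[where 'a = complex] mult.assoc
      sum_distrib_left)

lemma hermitian_udiag: "hermitian (udiag U d)"
  by (simp add: hermitian_def udiag_def ctranspose_mul matrix_mul_assoc)

lemma udiag_one: "unitary U \<Longrightarrow> udiag U (\<lambda>_. 1) = mat 1"
  by (simp add: udiag_def cdiag_one unitary_ctranspose)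

lemma cdiag_mul: "cdiag d ** cdiag e = cdiag (\<lambda>i. d i * e i)"
  by (simp add: vec_eq_iff cdiag_mul_left) (simp add: cdiag_def)

lemma unitary_conjugate: "unitary U \<Longrightarrow> ctranspose U ** udiag U d ** U = cdiag d"
  unfolding udiag_def
  by (metis matrix_mul_assoc matrix_mul_lid matrix_mul_rid unitary_ctranspose(1))

lemma udiag_mul:
  assumes "unitary U"
  shows "udiag U d ** udiag U e = udiag U (\<lambda>i. d i * e i)"
proof -
  have "udiag U d ** udiag U e = U ** cdiag d ** (ctranspose U ** U) ** cdiag e ** ctranspose U"
    by (simp add: udiag_def matrix_mul_assoc)
  also have "\<dots> = U ** (cdiag d ** cdiag e) ** ctranspose U"
    by (simp add: unitary_ctranspose[OF assms] matrix_mul_assoc)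
  finally show ?thesis by (simp add: udiag_def cdiag_mul)
qed

lemma unitary_mul:
  assumes "unitary U" "unitary V"
  shows "unitary (ctranspose U ** V)"
proof -
  have "ctranspose V ** U ** (ctranspose U ** V) = ctranspose V ** (U ** ctranspose U) ** V"
    by (simp add: matrix_mul_assoc)
  then show ?thesis
    using assms by (simp add: unitary_def ctranspose_mul unitary_ctranspose)
qed

lemma unitary_sum_col: "unitary U \<Longrightarrow> (\<Sum>i\<in>UNIV. (cmod (U $ i $ j))\<^sup>2) = 1"
proof -
  assume "unitary U"
  then have "(ctranspose U ** U) $ j $ j = 1" by (simp add: unitary_def mat_def)
  then have "of_real (\<Sum>i\<in>UNIV. (cmod (U $ i $ j))\<^sup>2) = (1 :: complex)"
    unfolding of_real_sum complex_norm_square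
    by (simp add: matrix_matrix_mult_def ctranspose_def mult.commute)
  then show ?thesis using of_real_eq_1_iff by blast
qed

lemma unitary_sum_row:
  assumes "unitary U"
  shows "(\<Sum>j\<in>UNIV. (cmod (U $ i $ j))\<^sup>2) = 1"
proof -
  have "unitary (ctranspose U)" using unitary_ctranspose[OF assms] by (simp add: unitary_def)
  from unitary_sum_col[OF this, of i] show ?thesis by (simp add: ctranspose_def)
qed

lemma unitary_norm:
  assumes "unitary U"
  shows "norm (U *v v) = norm v" "norm (ctranspose U *v v) = norm v"
proof -
  have "(U *v v) \<bullet> (U *v v) = v \<bullet> v"
    by (simp add: inner_matrix_left matrix_vector_mul_assoc unitary_ctranspose[OF assms])
  then show "norm (U *v v) = norm v" by (simp add: norm_eq)
  have "(ctranspose U *v v) \<bullet> (ctranspose U *v v) = v \<bullet> v"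
    by (simp add: inner_matrix_left matrix_vector_mul_assoc unitary_ctranspose[OF assms])
  then show "norm (ctranspose U *v v) = norm v" by (simp add: norm_eq)
qed

lemma det_udiag:
  assumes "unitary U"
  shows "det (udiag U d) = of_real (\<Prod>i\<in>UNIV. d i)"
proof -
  have "det (udiag U d) = det (ctranspose U ** U) * det (cdiag d)"
    by (simp add: udiag_def det_mul)
  also have "\<dots> = of_real (\<Prod>i\<in>UNIV. d i)"
    unfolding unitary_ctranspose[OF assms] by (subst det_diagonal) (simp_all add: cdiag_def)
  finally show ?thesis .
qed

lemma log_det_udiag:
  assumes "unitary U" "\<And>i. d i > 0"
  shows "log_det (udiag U d) = (\<Sum>i\<in>UNIV. ln (d i))"
  unfolding log_det_def det_udiag[OF assms(1)] Re_complex_of_real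
  using assms(2) by (subst ln_prod) (auto simp: less_imp_neq[symmetric])

lemma inner_udiag:
  "M \<bullet> udiag U d = (\<Sum>i\<in>UNIV. d i * Re ((ctranspose U ** M ** U) $ i $ i))"
proof -
  have "trace (ctranspose M ** udiag U d) = trace (ctranspose M ** (U ** cdiag d) ** ctranspose U)"
    by (simp add: udiag_def matrix_mul_assoc)
  also have "\<dots> = trace (ctranspose (ctranspose U ** M ** U) ** cdiag d)"
    by (subst trace_mul_sym) (simp add: ctranspose_mul matrix_mul_assoc)
  finally show ?thesis
    unfolding inner_eq_Re_trace
    by (simp add: trace_def cdiag_mul_right) (simp add: ctranspose_def mult.commute)
qed

lemma inner_udiag_vector:
  "v \<bullet> (udiag U d *v v) = (\<Sum>i\<in>UNIV. d i * (cmod ((ctranspose U *v v) $ i))\<^sup>2)"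
proof -
  have "v \<bullet> (udiag U d *v v) = (ctranspose U *v v) \<bullet> (cdiag d *v (ctranspose U *v v))"
    by (metis inner_matrix_left matrix_vector_mul_assoc udiag_def)
  also have "cdiag d *v w = (\<chi> i. d i *\<^sub>R w $ i)" for w :: "complex^'a"
    by (simp add: vec_eq_iff matrix_vector_mult_def cdiag_def if_distrib[of "\<lambda>c. c * _"]
        scaleR_conv_of_real[where 'a = complex] cong: if_cong)
  finally show ?thesis by (simp add: inner_vec_def power2_norm_eq_inner)
qed

lemma posdef_udiag_iff:
  assumes "unitary U"
  shows "posdef (udiag U d) \<longleftrightarrow> (\<forall>i. d i > 0)"
proof
  assume pos: "posdef (udiag U d)"
  show "\<forall>i. d i > 0"
  proof
    fix i
    let ?v = "U *v axis i 1"
    have "ctranspose U *v ?v = axis i 1"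
      by (simp add: matrix_vector_mul_assoc unitary_ctranspose[OF assms])
    then have "?v \<bullet> (udiag U d *v ?v) = d i"
      unfolding inner_udiag_vector
      by (simp add: axis_def if_distrib[of cmod]
          if_distrib[of "\<lambda>c. c\<^sup>2"] if_distrib[of "(*) _"] cong: if_cong)
    moreover have "?v \<noteq> 0"
      using unitary_norm(1)[OF assms, of "axis i 1"] by (auto simp: norm_axis_1)
    ultimately show "d i > 0"
      using pos by (auto simp: posdef_iff_inner)
  qed
next
  assume d: "\<forall>i. d i > 0"
  have "v \<bullet> (udiag U d *v v) > 0" if "v \<noteq> 0" for v
  proof -
    have "ctranspose U *v v \<noteq> 0"
      using that unitary_norm(2)[OF assms, of v] by auto
    then obtain i where "(ctranspose U *v v) $ i \<noteq> 0" by (auto simp: vec_eq_iff)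
    then show ?thesis
      unfolding inner_udiag_vector using d
      by (intro sum_pos2[of _ i]) (auto simp: less_imp_le)
  qed
  then show "posdef (udiag U d)" by (simp add: posdef_iff_inner hermitian_udiag)
qed

lemma posdef_spectral:
  assumes "posdef W"
  obtains U w where "unitary U" "W = udiag U w" "\<And>i. w i > 0"
  using assms hermitian_spectral[of W] by (metis posdef_def posdef_udiag_iff)

section \<open>The log-determinant of positive definite matrices\<close>

lemma posdef_inverse:
  fixes W :: "complex^'n^'n"
  assumes "posdef W"
  obtains R where "posdef R" "W ** R = mat 1" "R ** W = mat 1" "log_det R = - log_det W"
proof -
  obtain U w where U: "unitary U" "W = udiag U w" "\<And>i. w i > 0"
    using posdef_spectral[OF assms] by blast
  let ?R = "udiag U (\<lambda>i. 1 / w i)"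
  have nz: "w i \<noteq> 0" for i using U(3)[of i] by simp
  show thesis
  proof (rule that)
    show "posdef ?R" using U by (simp add: posdef_udiag_iff)
    show "W ** ?R = mat 1" "?R ** W = mat 1" using U nz by (simp_all add: udiag_mul udiag_one)
    show "log_det ?R = - log_det W"
      using U by (simp add: log_det_udiag ln_div nz sum_negf)
  qed
qed

text \<open>Let \<open>w\<close> and \<open>x\<close> be the eigenvalues of \<open>W\<close> and \<open>X\<close>, and \<open>Q\<close> the unitary change between their
  eigenbases. The matrix \<open>P\<close> of the squared moduli of the entries of \<open>Q\<close> is doubly stochastic and
  \<open>W \<bullet> X\<close> is the sum of \<open>P i j * (w i * x j)\<close>, so the inequality is the average over \<open>P\<close> of
  \<open>ln s \<le> s - 1\<close> at \<open>s = w i * x j\<close>. In the case of equality \<open>w i * x j = 1\<close> wherever \<open>Q\<close> does not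
  vanish, which is the statement \<open>W ** X = mat 1\<close> in these bases.\<close>

lemma log_det_trace_ineq:
  fixes W X :: "complex^'n^'n"
  assumes "posdef W" "posdef X"
  shows "log_det W + log_det X \<le> W \<bullet> X - real CARD('n)"
    and "log_det W + log_det X = W \<bullet> X - real CARD('n) \<Longrightarrow> W ** X = mat 1"
proof -
  obtain U w where U: "unitary U" "W = udiag U w" "\<And>i. w i > 0"
    using posdef_spectral[OF assms(1)] by blast
  obtain V x where V: "unitary V" "X = udiag V x" "\<And>i. x i > 0"
    using posdef_spectral[OF assms(2)] by blast
  define Q where "Q = ctranspose U ** V"
  have Q: "unitary Q" unfolding Q_def using U V by (intro unitary_mul)
  define P where "P i j = (cmod (Q $ i $ j))\<^sup>2" for i j
  have P_col: "(\<Sum>i\<in>UNIV. P i j) = 1" and P_row: "(\<Sum>j\<in>UNIV. P i j) = 1" for i j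
    unfolding P_def using Q by (simp_all add: unitary_sum_col unitary_sum_row)
  have "ctranspose V ** W ** V = ctranspose Q ** (cdiag w ** Q)"
    by (simp add: Q_def U(2) udiag_def ctranspose_mul matrix_mul_assoc)
  then have "(ctranspose V ** W ** V) $ j $ j
      = (\<Sum>i\<in>UNIV. cnj (Q $ i $ j) * (of_real (w i) * Q $ i $ j))" for j
    by (simp add: matrix_matrix_mult_def[of "ctranspose Q"] cdiag_mul_left)
      (simp add: ctranspose_def)
  also have "\<dots> j = of_real (\<Sum>i\<in>UNIV. w i * P i j)" for j
    unfolding P_def of_real_sum of_real_mult complex_norm_square by (simp add: mult_ac)
  finally have "Re ((ctranspose V ** W ** V) $ j $ j) = (\<Sum>i\<in>UNIV. w i * P i j)" for j
    by (simp only: Re_complex_of_real)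
  then have WX: "W \<bullet> X = (\<Sum>j\<in>UNIV. \<Sum>i\<in>UNIV. P i j * (w i * x j))"
    unfolding V(2) by (simp add: inner_udiag sum_distrib_left mult_ac)
  have n: "real CARD('n) = (\<Sum>j\<in>UNIV. \<Sum>i\<in>UNIV. P i j)"
    by (simp add: P_col)
  have "log_det X = (\<Sum>j\<in>UNIV. ln (x j) * (\<Sum>i\<in>UNIV. P i j))"
    using V by (simp add: log_det_udiag P_col)
  then have lX: "log_det X = (\<Sum>j\<in>UNIV. \<Sum>i\<in>UNIV. P i j * ln (x j))"
    by (simp add: sum_distrib_left mult_ac)
  have "log_det W = (\<Sum>i\<in>UNIV. ln (w i) * (\<Sum>j\<in>UNIV. P i j))"
    using U by (simp add: log_det_udiag P_row)
  also have "\<dots> = (\<Sum>i\<in>UNIV. \<Sum>j\<in>UNIV. P i j * ln (w i))"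
    by (simp add: sum_distrib_left mult_ac)
  also have "\<dots> = (\<Sum>j\<in>UNIV. \<Sum>i\<in>UNIV. P i j * ln (w i))"
    by (rule sum.swap)
  finally have lW: "log_det W = (\<Sum>j\<in>UNIV. \<Sum>i\<in>UNIV. P i j * ln (w i))" .
  define g where "g i j = P i j * (w i * x j - 1 - ln (w i * x j))" for i j
  have gap: "W \<bullet> X - real CARD('n) - log_det W - log_det X = (\<Sum>j\<in>UNIV. \<Sum>i\<in>UNIV. g i j)"
    unfolding WX n lX lW g_def using U(3) V(3)
    by (simp add: ln_mult_pos algebra_simps sum.distrib sum_subtractf)
  have ln_le: "ln (w i * x j) \<le> w i * x j - 1" for i j
    using U(3) V(3) by (intro ln_le_minus_one) simp
  have g_nonneg: "g i j \<ge> 0" for i j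
    unfolding g_def P_def using ln_le[of i j] by simp
  then have "(\<Sum>j\<in>UNIV. \<Sum>i\<in>UNIV. g i j) \<ge> 0" by (intro sum_nonneg)
  with gap show "log_det W + log_det X \<le> W \<bullet> X - real CARD('n)" by linarith
  assume "log_det W + log_det X = W \<bullet> X - real CARD('n)"
  with gap have "(\<Sum>j\<in>UNIV. \<Sum>i\<in>UNIV. g i j) = 0" by linarith
  then have g0: "g i j = 0" for i j
    using g_nonneg by (simp add: sum_nonneg_eq_0_iff sum_nonneg)
  have "of_real (w i) * Q $ i $ j * of_real (x j) = Q $ i $ j" for i j
  proof (cases "P i j = 0")
    case False
    then have "ln (w i * x j) = w i * x j - 1" using g0[of i j] by (simp add: g_def)
    then have "w i * x j = 1" using U(3) V(3) by (intro ln_eq_minus_one) simp_all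
    then have "of_real (w i) * of_real (x j) = (1 :: complex)" by (simp flip: of_real_mult)
    then show ?thesis by (simp add: mult_ac)
  qed (simp add: P_def)
  then have "cdiag w ** Q ** cdiag x = Q"
    by (simp add: vec_eq_iff cdiag_mul_left cdiag_mul_right)
  then have "W ** X = U ** Q ** ctranspose V"
    unfolding U(2) V(2) udiag_def by (metis Q_def matrix_mul_assoc)
  also have "\<dots> = (U ** ctranspose U) ** (V ** ctranspose V)"
    by (simp add: Q_def matrix_mul_assoc)
  also have "\<dots> = mat 1" using U V by (simp add: unitary_ctranspose)
  finally show "W ** X = mat 1" .
qed

text \<open>Strict concavity of \<open>log_det\<close>: its graph lies below the tangent plane at \<open>W\<close>, whose slope is the
  inverse \<open>R\<close> of \<open>W\<close>, and touches it only there.\<close>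

lemma log_det_tangent:
  assumes "posdef W" "posdef R" "W ** R = mat 1" "posdef X"
  shows "log_det X \<le> log_det W + R \<bullet> (X - W)"
    and "log_det X = log_det W + R \<bullet> (X - W) \<Longrightarrow> X = W"
proof -
  obtain S where S: "posdef S" "W ** S = mat 1" "S ** W = mat 1" "log_det S = - log_det W"
    using posdef_inverse[OF assms(1)] by blast
  have R: "R = S" 
    by (metis assms(3) S(3) matrix_mul_assoc matrix_mul_lid matrix_mul_rid)
  have n: "R \<bullet> W = real CARD('a)"
    using S by (simp add: R inner_eq_Re_trace posdef_def hermitian_def trace_I)
  show "log_det X \<le> log_det W + R \<bullet> (X - W)"
    using log_det_trace_ineq(1)[OF assms(2,4)] S(4) n by (simp add: R inner_diff_right)
  assume "log_det X = log_det W + R \<bullet> (X - W)"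
  then have "R ** X = mat 1"
    using S(4) n by (intro log_det_trace_ineq(2) assms) (simp add: R inner_diff_right)
  then show "X = W"
    by (metis R S(2) matrix_mul_assoc matrix_mul_lid matrix_mul_rid)
qed

lemma log_det_minimizer:
  assumes "posdef W" "posdef R" "W ** R = mat 1"
  shows "is_unique_arg_min (\<lambda>X. - log_det X + W \<bullet> X) posdef R"
proof (rule is_unique_arg_minI)
  have RW: "R ** W = mat 1" using assms(3) matrix_left_right_inverse by blast
  fix X :: "complex^'a^'a" assume X: "posdef X" "X \<noteq> R"
  then have "log_det X < log_det R + W \<bullet> (X - R)"
    using log_det_tangent[OF assms(2,1) RW X(1)] by force
  then show "- log_det R + W \<bullet> R < - log_det X + W \<bullet> X"
    by (simp add: inner_diff_right)
qed (fact assms(2))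

lemma det_differentiable: "(det :: complex^'n^'n \<Rightarrow> complex) differentiable (at M)"
proof -
  have nth: "((\<lambda>M :: complex^'n^'n. M $ i $ j) has_derivative (\<lambda>H. H $ i $ j)) (at M)" for i j
    by (intro bounded_linear_imp_has_derivative
        bounded_linear_compose[OF bounded_linear_vec_nth bounded_linear_vec_nth])
  show ?thesis
    unfolding differentiable_def det_def
    by (rule exI, (rule has_derivative_sum has_derivative_mult_right has_derivative_prod nth)+)
qed

text \<open>The quadratic form of \<open>W\<close> is at least \<open>c * (norm v)\<^sup>2\<close> for its least eigenvalue \<open>c\<close>, and that of
  \<open>H\<close> is bounded by the spectral norm.\<close>

lemma posdef_near:
  fixes W H :: "complex^'n^'n"
  assumes "posdef W" "hermitian H"
  obtains e where "e > 0" "\<And>t. \<bar>t\<bar> < e \<Longrightarrow> posdef (W + t *\<^sub>R H)"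
proof -
  obtain U w where U: "unitary U" "W = udiag U w" "\<And>i. w i > 0"
    using posdef_spectral[OF assms(1)] by blast
  define c where "c = Min (range w)"
  have c: "c > 0" "\<And>i. c \<le> w i" using U(3) by (auto simp: c_def)
  define b where "b = spectral_norm H"
  have b: "norm (H *v v) \<le> b * norm v" "b \<ge> 0" for v
    unfolding b_def spectral_norm_def
    by (simp_all add: onorm onorm_pos_le bounded_linear_matrix_vector)
  have W: "c * (norm v)\<^sup>2 \<le> v \<bullet> (W *v v)" for v
  proof -
    have "c * (norm v)\<^sup>2 = (\<Sum>i\<in>UNIV. c * (cmod ((ctranspose U *v v) $ i))\<^sup>2)"
      unfolding unitary_norm(2)[OF U(1), of v, symmetric]
      by (simp add: norm_vec_def L2_set_def sum_nonneg sum_distrib_left)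
    also have "\<dots> \<le> v \<bullet> (W *v v)"
      unfolding U(2) inner_udiag_vector by (intro sum_mono mult_right_mono c) simp
    finally show ?thesis .
  qed
  have "posdef (W + t *\<^sub>R H)" if t: "\<bar>t\<bar> < c / (b + 1)" for t
    unfolding posdef_iff_inner
  proof safe
    show "hermitian (W + t *\<^sub>R H)"
      using assms by (simp add: posdef_def hermitian_def ctranspose_add ctranspose_scaleR)
    fix v :: "complex^'n" assume "v \<noteq> 0"
    have "\<bar>v \<bullet> (H *v v)\<bar> \<le> norm v * norm (H *v v)" by (rule Cauchy_Schwarz_ineq2)
    also have "\<dots> \<le> (norm v)\<^sup>2 * b"
      using mult_left_mono[OF b(1)[of v] norm_ge_zero[of v]] by (simp add: power2_eq_square mult_ac)
    finally have H: "\<bar>v \<bullet> (H *v v)\<bar> \<le> (norm v)\<^sup>2 * b" .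
    have "\<bar>t\<bar> * b < c"
    proof -
      have "\<bar>t\<bar> * b \<le> \<bar>t\<bar> * (b + 1)" by (simp add: mult_left_mono)
      also have "\<dots> < c" using t b(2) by (simp add: pos_less_divide_eq)
      finally show ?thesis .
    qed
    have "\<bar>t * (v \<bullet> (H *v v))\<bar> \<le> \<bar>t\<bar> * ((norm v)\<^sup>2 * b)"
      unfolding abs_mult by (intro mult_left_mono H) simp
    also have "\<dots> = (norm v)\<^sup>2 * (\<bar>t\<bar> * b)" by simp
    also have "\<dots> < (norm v)\<^sup>2 * c" using \<open>\<bar>t\<bar> * b < c\<close> \<open>v \<noteq> 0\<close> by simp
    finally have "- (t * (v \<bullet> (H *v v))) < c * (norm v)\<^sup>2" by (simp add: mult.commute)
    moreover have "v \<bullet> ((W + t *\<^sub>R H) *v v) = v \<bullet> (W *v v) + t * (v \<bullet> (H *v v))"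
    proof -
      have "(t *\<^sub>R H) *v v = t *\<^sub>R (H *v v)"
        by (simp add: matrix_vector_mult_def vec_eq_iff scaleR_sum_right)
      then show ?thesis by (simp add: matrix_vector_mult_add_rdistrib inner_add_right)
    qed
    ultimately show "v \<bullet> ((W + t *\<^sub>R H) *v v) > 0" using W[of v] by linarith
  qed
  moreover have "c / (b + 1) > 0" using c(1) b(2) by simp
  ultimately show thesis by (rule that[rotated])
qed

text \<open>The determinant is a polynomial, so \<open>log_det\<close> has some derivative \<open>F\<close> at \<open>W\<close>. That \<open>F\<close> is given by
  \<open>R\<close> on Hermitian directions needs no computation: by \<open>log_det_tangent\<close>, the function
  \<open>log_det (W + t *\<^sub>R H) - t * (R \<bullet> H)\<close> of \<open>t\<close> has a local maximum at \<open>0\<close>.\<close>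

lemma log_det_has_derivative:
  fixes W R :: "complex^'n^'n"
  assumes "posdef W" "posdef R" "W ** R = mat 1"
  shows "(log_det has_derivative (\<lambda>H. R \<bullet> H)) (at W within Collect hermitian)"
proof -
  obtain U w where U: "unitary U" "W = udiag U w" "\<And>i. w i > 0"
    using posdef_spectral[OF assms(1)] by blast
  have pos: "Re (det W) > 0"
    unfolding U(2) det_udiag[OF U(1)] Re_complex_of_real using U(3) by (simp add: prod_pos)
  obtain D where "(det has_derivative D) (at W)"
    using det_differentiable[of W] by (auto simp: differentiable_def)
  then have "((\<lambda>M. Re (det M)) has_derivative (\<lambda>H. Re (D H))) (at W)"
    by (rule bounded_linear.has_derivative[OF bounded_linear_Re])
  from has_derivative_ln[OF pos this] obtain F where F: "(log_det has_derivative F) (at W)"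
    unfolding log_det_def by blast
  have "R \<bullet> H = F H" if H: "hermitian H" for H
  proof -
    obtain e where e: "e > 0" "\<And>t. \<bar>t\<bar> < e \<Longrightarrow> posdef (W + t *\<^sub>R H)"
      using posdef_near[OF assms(1) H] by blast
    define \<phi> where "\<phi> t = log_det (W + t *\<^sub>R H) - t * (R \<bullet> H)" for t
    have "((\<lambda>t. W + t *\<^sub>R H) has_derivative (\<lambda>t. t *\<^sub>R H)) (at 0)"
      by (auto intro!: derivative_eq_intros)
    from has_derivative_compose[OF this, of log_det F] F
    have "((\<lambda>t. log_det (W + t *\<^sub>R H)) has_derivative (\<lambda>t. F (t *\<^sub>R H))) (at 0)" by simp
    moreover have "(\<lambda>t. F (t *\<^sub>R H)) = (*) (F H)"
      by (simp add: fun_eq_iff linear_cmul[OF has_derivative_linear[OF F]])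
    ultimately have "((\<lambda>t. log_det (W + t *\<^sub>R H)) has_real_derivative F H) (at 0)"
      by (simp add: has_field_derivative_def)
    then have "(\<phi> has_real_derivative F H - R \<bullet> H) (at 0)"
      unfolding \<phi>_def by (auto intro!: derivative_eq_intros)
    moreover have "\<phi> t \<le> \<phi> 0" if "\<bar>0 - t\<bar> < e" for t
      using log_det_tangent(1)[OF assms e(2), of t] that by (simp add: \<phi>_def)
    ultimately have "F H - R \<bullet> H = 0" using e(1) by (intro DERIV_local_max) auto
    then show ?thesis by simp
  qed
  then show ?thesis
    using F assms(1)
    by (intro has_derivative_within_subspace[OF has_derivative_at_withinI[OF F]])
      (auto simp: subspace_hermitian posdef_def bounded_linear_inner_right)
qed

section \<open>Spectral and nuclear norm\<close>

lemma poly_characteristic_poly: "poly (characteristic_poly M) z = det (mat z - M)"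
proof -
  have "poly (characteristic_poly M) z
      = (\<Sum>p | p permutes UNIV. of_int (sign p) * (\<Prod>i\<in>UNIV. (mat z - M) $ i $ p i))"
    unfolding characteristic_poly_def det_def poly_sum poly_mult poly_prod
    by (intro sum.cong prod.cong refl arg_cong2[where f = "(*)"]) (auto simp: mat_def)
  then show ?thesis by (simp add: det_def)
qed

lemma characteristic_poly_udiag:
  assumes "unitary U"
  shows "characteristic_poly (udiag U e) = (\<Prod>i\<in>UNIV. [:- of_real (e i), 1:])"
proof -
  \<comment> \<open>As polynomials over the complex numbers, both sides agree if their
    values do; this avoids matrices of polynomials.\<close>
  have "det (mat z - udiag U e) = (\<Prod>i\<in>UNIV. z - of_real (e i))" for z
  proof -
    have "udiag U e ** U = U ** cdiag e"
      unfolding udiag_def by (metis assms matrix_mul_assoc matrix_mul_rid unitary_ctranspose(1))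
    moreover have "(mat z - udiag U e) ** U = mat z ** U - udiag U e ** U"
      by (simp add: matrix_matrix_mult_def vec_eq_iff left_diff_distrib sum_subtractf)
    moreover have "U ** (mat z - cdiag e) = U ** mat z - U ** cdiag e"
      by (simp add: matrix_matrix_mult_def vec_eq_iff right_diff_distrib sum_subtractf)
    moreover have "mat z ** U = U ** mat z"
      by (simp add: matrix_matrix_mult_def vec_eq_iff mat_def if_distrib[of "(*) _"]
          if_distrib[of "\<lambda>c. c * _"] cong: if_cong)
    ultimately have "(mat z - udiag U e) ** U = U ** (mat z - cdiag e)" by simp
    then have "det (mat z - udiag U e) * det U = det U * det (mat z - cdiag e)"
      by (metis det_mul)
    moreover have "det (ctranspose U) * det U = 1"
      using assms unfolding unitary_def by (metis det_mul det_I)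
    then have "det U \<noteq> 0" by auto
    ultimately have "det (mat z - udiag U e) = det (mat z - cdiag e)" by simp
    also have "\<dots> = (\<Prod>i\<in>UNIV. z - of_real (e i))"
      by (subst det_diagonal) (simp_all add: mat_def cdiag_def)
    finally show ?thesis .
  qed
  then have "poly (characteristic_poly (udiag U e)) = poly (\<Prod>i\<in>UNIV. [:- of_real (e i), 1:])"
    by (simp add: fun_eq_iff poly_characteristic_poly poly_prod)
  then show ?thesis by (simp only: poly_eq_poly_eq_iff)
qed

lemma order_prod_linear:
  fixes a :: "'b \<Rightarrow> 'a::idom"
  assumes "finite I"
  shows "order x (\<Prod>i\<in>I. [:- a i, 1:]) = card {i \<in> I. a i = x}"
  using assms
proof (induction I rule: finite_induct)
  case (insert j I)
  have "order x [:- a j, 1:] = (if a j = x then 1 else 0)"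
    using order_power_n_n[of x 1] by (auto intro!: order_0I)
  moreover have "{i \<in> insert j I. a i = x} = (if a j = x then insert j {i \<in> I. a i = x} else {i \<in> I. a i = x})"
    by auto
  moreover have "(\<Prod>i\<in>insert j I. [:- a i, 1:]) \<noteq> 0"
    using insert.hyps(1) by simp
  ultimately show ?case
    using insert by (simp add: order_mult del: mult_pCons_left)
qed simp

text \<open>The singular values of a Hermitian matrix are the absolute values of its eigenvalues. The sum
  over roots with multiplicity in \<open>nuclear_norm\<close> is regrouped as a sum over indices, grouping the
  indices by the value of \<open>(d i)\<^sup>2\<close>.\<close>

lemma nuclear_norm_udiag:
  fixes U :: "complex^'n^'n"
  assumes "unitary U"
  shows "nuclear_norm (udiag U d) = (\<Sum>i\<in>UNIV. \<bar>d i\<bar>)"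
proof -
  define e where "e i = complex_of_real (d i * d i)" for i
  define q where "q = (\<Prod>i\<in>UNIV. [:- e i, 1:])"
  have "characteristic_poly (ctranspose (udiag U d) ** udiag U d) = q"
    using hermitian_udiag[of U d]
    by (simp add: hermitian_def udiag_mul assms characteristic_poly_udiag q_def e_def)
  then have "nuclear_norm (udiag U d) = (\<Sum>x | poly q x = 0. real (order x q) * sqrt (Re x))"
    by (simp add: nuclear_norm_def)
  also have "{x. poly q x = 0} = range e"
    by (auto simp: q_def poly_prod prod_zero_iff)
  also have "(\<Sum>x\<in>range e. real (order x q) * sqrt (Re x))
      = (\<Sum>x\<in>range e. \<Sum>i | i \<in> UNIV \<and> e i = x. sqrt (Re (e i)))"
    unfolding q_def by (simp add: order_prod_linear)
  also have "\<dots> = (\<Sum>i\<in>UNIV. sqrt (Re (e i)))"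
    by (rule sum.image_gen[symmetric]) simp
  finally show ?thesis by (simp add: e_def)
qed

lemma nuclear_norm_nonneg:
  assumes "hermitian Z"
  shows "nuclear_norm Z \<ge> 0"
proof -
  obtain U d where "unitary U" "Z = udiag U d"
    using hermitian_spectral[OF assms] by blast
  then show ?thesis by (simp add: nuclear_norm_udiag sum_nonneg)
qed

lemma nuclear_norm_scaleR:
  assumes "hermitian Z"
  shows "nuclear_norm (c *\<^sub>R Z) = \<bar>c\<bar> * nuclear_norm Z"
proof -
  obtain U d where U: "unitary U" "Z = udiag U d"
    using hermitian_spectral[OF assms] by blast
  then show ?thesis
    by (simp add: udiag_scaleR nuclear_norm_udiag abs_mult sum_distrib_left)
qed

lemma matrix_nth_eq_cdot: "N $ i $ j = cdot (axis i 1) (N *v axis j 1)"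
  by (simp add: cdot_def matrix_vector_mult_def axis_def if_distrib[of cnj] if_distrib[of "\<lambda>c. c * _"]
      if_distrib[of "(*) _"] cong: if_cong)

text \<open>Duality of the two norms: in an eigenbasis of \<open>Z\<close> the inner product only involves the diagonal
  of \<open>V\<close>, whose entries are at most the spectral norm.\<close>

lemma abs_inner_le_spectral_nuclear:
  fixes V Z :: "complex^'n^'n"
  assumes "hermitian Z"
  shows "\<bar>V \<bullet> Z\<bar> \<le> spectral_norm V * nuclear_norm Z"
proof -
  obtain U d where U: "unitary U" "Z = udiag U d"
    using hermitian_spectral[OF assms] by blast
  have le: "\<bar>Re ((ctranspose U ** V ** U) $ i $ i)\<bar> \<le> spectral_norm V" for i
  proof -
    let ?u = "U *v axis i 1"
    have u: "norm ?u = 1" by (simp add: unitary_norm U norm_axis_1)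
    have "(ctranspose U ** V ** U) $ i $ i = cdot ?u (V *v ?u)"
      unfolding matrix_nth_eq_cdot[of "ctranspose U ** V ** U"]
      by (simp add: cdot_matrix_left[of _ "ctranspose U"] flip: matrix_vector_mul_assoc)
    then have "\<bar>Re ((ctranspose U ** V ** U) $ i $ i)\<bar> \<le> norm ?u * norm (V *v ?u)"
      using cdot_norm_le[of ?u "V *v ?u"] abs_Re_le_cmod[of "cdot ?u (V *v ?u)"] by simp
    also have "\<dots> \<le> spectral_norm V"
      using onorm[OF bounded_linear_matrix_vector, of V ?u] by (simp add: u spectral_norm_def)
    finally show ?thesis .
  qed
  have "\<bar>V \<bullet> Z\<bar> \<le> (\<Sum>i\<in>UNIV. \<bar>d i\<bar> * spectral_norm V)"
    unfolding U(2) inner_udiag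
    by (rule order_trans[OF sum_abs]) (auto simp: abs_mult intro!: sum_mono mult_left_mono le)
  also have "\<dots> = spectral_norm V * nuclear_norm Z"
    by (simp add: U nuclear_norm_udiag sum_distrib_right mult.commute[of "spectral_norm V"])
  finally show ?thesis .
qed

lemma spectral_norm_udiag_le:
  assumes "unitary U" "\<And>i. \<bar>d i\<bar> \<le> c"
  shows "spectral_norm (udiag U d) \<le> c"
  unfolding spectral_norm_def
proof (rule onorm_bound)
  show "c \<ge> 0" using assms(2) abs_ge_zero order_trans by blast
  fix v
  define w where "w = ctranspose U *v v"
  have "norm (udiag U d *v v) = norm (cdiag d *v w)"
    by (simp add: w_def udiag_def unitary_norm(1)[OF assms(1)] flip: matrix_vector_mul_assoc)
  also have "\<dots> \<le> norm (c *\<^sub>R w)"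
  proof (rule norm_le_componentwise_cart)
    fix i
    have "(cdiag d *v w) $ i = of_real (d i) * w $ i"
      by (simp add: matrix_vector_mult_def cdiag_def if_distrib[of "\<lambda>c. c * _"] cong: if_cong)
    then show "norm ((cdiag d *v w) $ i) \<le> norm ((c *\<^sub>R w) $ i)"
      using assms(2)[of i] by (simp add: norm_mult mult_right_mono)
  qed
  also have "\<dots> = c * norm v"
    using \<open>c \<ge> 0\<close> by (simp add: w_def unitary_norm(2)[OF assms(1)])
  finally show "norm (udiag U d *v v) \<le> c * norm v" .
qed

text \<open>\<open>P\<close> arises from \<open>V\<close> by clipping the eigenvalues to the interval from \<open>- \<gamma>\<close> to \<open>\<gamma>\<close>. Where this
  changes an eigenvalue, that of \<open>P\<close> is \<open>\<gamma>\<close> with the sign of the difference; hence the last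
  equation, which is the case of equality in the duality of the norms.\<close>

lemma spectral_ball_decomposition:
  fixes V :: "complex^'n^'n"
  assumes V: "hermitian V" and "\<gamma> \<ge> 0"
  obtains P T where "hermitian P" "hermitian T" "V = P + T" "spectral_norm P \<le> \<gamma>"
    "P \<bullet> T = \<gamma> * nuclear_norm T"
proof -
  obtain U v where U: "unitary U" "V = udiag U v"
    using hermitian_spectral[OF V] by blast
  define p where "p i = max (- \<gamma>) (min \<gamma> (v i))" for i
  define t where "t i = v i - p i" for i
  have pt: "t i * p i = \<gamma> * \<bar>t i\<bar>" for i
    using \<open>\<gamma> \<ge> 0\<close> by (auto simp: t_def p_def max_def min_def abs_if algebra_simps)
  show thesis
  proof (rule that)
    show "hermitian (udiag U p)" "hermitian (udiag U t)" by (rule hermitian_udiag)+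
    have "udiag U t = V - udiag U p"
      unfolding U(2) udiag_diff t_def ..
    then show "V = udiag U p + udiag U t" by simp
    show "spectral_norm (udiag U p) \<le> \<gamma>"
      using \<open>\<gamma> \<ge> 0\<close> by (intro spectral_norm_udiag_le U(1)) (auto simp: p_def abs_le_iff)
    show "udiag U p \<bullet> udiag U t = \<gamma> * nuclear_norm (udiag U t)"
      unfolding inner_udiag[of _ U t] unitary_conjugate[OF U(1)] nuclear_norm_udiag[OF U(1)]
        sum_distrib_left by (simp add: cdiag_def pt)
  qed
qed

text \<open>By duality, \<open>\<gamma> * nuclear_norm W\<close> is bounded below by the linear function \<open>- (P \<bullet> W)\<close>, with equality
  at the claimed minimizer. Replacing it by this bound leaves a strictly convex quadratic whose
  critical point is the same matrix.\<close>

lemma nuclear_norm_prox: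
  fixes Y B P T :: "complex^'n^'n"
  assumes "\<rho> > 0" "Y + \<rho> *\<^sub>R B = P + T" "hermitian T" "spectral_norm P \<le> \<gamma>"
    "P \<bullet> T = \<gamma> * nuclear_norm T"
  shows "is_unique_arg_min
    (\<lambda>W. c + \<gamma> * nuclear_norm W + Y \<bullet> (B + W) + \<rho> / 2 * (norm (B + W))\<^sup>2) hermitian
    (- (1 / \<rho>) *\<^sub>R T)" (is "is_unique_arg_min ?f _ ?Z")
proof (rule is_unique_arg_minI)
  show "hermitian ?Z" using assms(3) by (simp only: hermitian_def ctranspose_scaleR)
  fix W :: "complex^'n^'n" assume W: "hermitian W" "W \<noteq> ?Z"
  have P: "Y + \<rho> *\<^sub>R (B + ?Z) = P"
    using assms(1,2) by (simp add: algebra_simps)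
  have Z: "\<gamma> * nuclear_norm ?Z = - (P \<bullet> ?Z)"
    using assms(1,5) nuclear_norm_scaleR[OF assms(3), of "- (1 / \<rho>)"] by simp
  have "spectral_norm P * nuclear_norm W \<le> \<gamma> * nuclear_norm W"
    using assms(4) nuclear_norm_nonneg[OF W(1)] by (rule mult_right_mono)
  then have le: "- (P \<bullet> W) \<le> \<gamma> * nuclear_norm W"
    using abs_inner_le_spectral_nuclear[OF W(1), of P] by linarith
  have "norm (W - ?Z) > 0"
    using W(2) unfolding zero_less_norm_iff right_minus_eq .
  then have pos: "0 < \<rho> / 2 * (norm (W - ?Z))\<^sup>2"
    using assms(1) by (intro mult_pos_pos) simp_all
  have gap: "?f W - ?f V = \<gamma> * nuclear_norm W - \<gamma> * nuclear_norm V
      + (Y + \<rho> *\<^sub>R (B + V)) \<bullet> (W - V) + \<rho> / 2 * (norm (W - V))\<^sup>2" for V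
  proof -
    have sq: "(norm (B + W))\<^sup>2 = (norm (B + V))\<^sup>2 + 2 * ((B + V) \<bullet> (W - V)) + (norm (W - V))\<^sup>2"
      using diff_norm_square[of W "- B" V] by (simp add: add.commute)
    show ?thesis
      unfolding sq by (simp add: algebra_simps inner_add_left inner_add_right inner_diff_right)
  qed
  show "?f ?Z < ?f W"
    using gap[of ?Z] le pos unfolding P Z inner_diff_right by linarith
qed

section \<open>The operators of the covariance completion problem\<close>

lemma inner_mul_left: "(M ** N) \<bullet> R = N \<bullet> (ctranspose M ** R)"
  by (simp add: inner_eq_Re_trace ctranspose_mul matrix_mul_assoc)

lemma inner_mul_right: "(M ** N) \<bullet> R = M \<bullet> (R ** ctranspose N)"
proof -
  have "trace (ctranspose N ** (ctranspose M ** R)) = trace (ctranspose M ** R ** ctranspose N)"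
    by (rule trace_mul_sym)
  then show ?thesis by (simp add: inner_eq_Re_trace ctranspose_mul matrix_mul_assoc)
qed

lemma inner_A1: "A1 A X \<bullet> Y = X \<bullet> A1_adj A Y"
  by (simp add: A1_def A1_adj_def inner_add_left inner_add_right inner_mul_left[of A]
      inner_mul_right[of X])

text \<open>An entry of \<open>E\<close> may be moved across the real inner product because it is real.\<close>

lemma inner_A2:
  assumes "\<forall>i j. E $ i $ j = 0 \<or> E $ i $ j = 1"
  shows "A2 C E X \<bullet> Y = X \<bullet> A2_adj C E Y"
proof -
  have "hadamard M E \<bullet> Y = M \<bullet> hadamard E Y" for M
    unfolding inner_vec_def
  proof (intro sum.cong refl)
    fix i j
    show "hadamard M E $ i $ j \<bullet> Y $ i $ j = M $ i $ j \<bullet> hadamard E Y $ i $ j"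
      using assms[rule_format, of i j] by (auto simp: hadamard_def)
  qed
  then show ?thesis
    by (simp add: A2_def A2_adj_def inner_mul_left[of C] inner_mul_right[of "C ** X"] matrix_mul_assoc)
qed

lemma hermitian_hadamard:
  assumes "transpose E = E" "\<forall>i j. E $ i $ j = 0 \<or> E $ i $ j = 1" "hermitian M"
  shows "hermitian (hadamard M E)" "hermitian (hadamard E M)"
proof -
  have "cnj (E $ j $ i) = E $ i $ j" for i j
  proof -
    have "cnj (E $ j $ i) = E $ j $ i" using assms(2)[rule_format, of j i] by auto
    also have "\<dots> = transpose E $ i $ j" by (simp add: transpose_def)
    finally show ?thesis by (simp add: assms(1))
  qed
  moreover have "cnj (M $ j $ i) = M $ i $ j" for i j
    using assms(3) by (auto simp: hermitian_def ctranspose_def vec_eq_iff)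
  ultimately show "hermitian (hadamard M E)" "hermitian (hadamard E M)"
    by (simp_all add: hermitian_def hadamard_def ctranspose_def)
qed

lemma hermitian_add: "hermitian M \<Longrightarrow> hermitian N \<Longrightarrow> hermitian (M + N)"
  by (simp add: hermitian_def ctranspose_add)

lemma hermitian_diff: "hermitian M \<Longrightarrow> hermitian N \<Longrightarrow> hermitian (M - N)"
  by (simp add: hermitian_def ctranspose_diff)

lemma hermitian_scaleR: "hermitian M \<Longrightarrow> hermitian (c *\<^sub>R M)"
  by (simp add: hermitian_def ctranspose_scaleR)

lemma hermitian_congruence: "hermitian M \<Longrightarrow> hermitian (C ** M ** ctranspose C)"
  by (simp add: hermitian_def ctranspose_mul matrix_mul_assoc)

lemma hermitian_A1: "hermitian X \<Longrightarrow> hermitian (A1 A X)"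
  by (simp add: hermitian_def A1_def ctranspose_add ctranspose_mul add.commute)

lemma hermitian_A2:
  assumes "transpose E = E" "\<forall>i j. E $ i $ j = 0 \<or> E $ i $ j = 1" "hermitian X"
  shows "hermitian (A2 C E X)"
  unfolding A2_def by (intro hermitian_hadamard hermitian_congruence assms)

lemma hermitian_A_adj:
  assumes "transpose E = E" "\<forall>i j. E $ i $ j = 0 \<or> E $ i $ j = 1" "hermitian Y1" "hermitian Y2"
  shows "hermitian (A_adj A C E Y1 Y2)"
proof -
  have "hermitian (A1_adj A Y1)"
    using hermitian_A1[of Y1 "ctranspose A"] assms(3) by (simp add: A1_def A1_adj_def)
  moreover have "hermitian (A2_adj C E Y2)"
    using hermitian_congruence[OF hermitian_hadamard(2)[OF assms(1,2,4)], of "ctranspose C"]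
    by (simp add: A2_adj_def)
  ultimately show ?thesis by (simp add: A_adj_def hermitian_add)
qed

lemma bounded_linear_A1_adj: "bounded_linear (A1_adj A)"
proof -
  have "linear (A1_adj A)"
    by (rule linearI) (simp_all add: A1_adj_def matrix_matrix_mult_def vec_eq_iff algebra_simps
        sum.distrib scaleR_sum_right)
  then show ?thesis by (simp add: linear_conv_bounded_linear)
qed

lemma matrix_add_rdistrib: "(M + N) ** R = M ** R + N ** (R :: 'a::semiring_1^'m^'k)"
  by (simp add: matrix_matrix_mult_def vec_eq_iff distrib_right sum.distrib)

lemma bounded_linear_A2_adj: "bounded_linear (A2_adj C E)"
proof -
  have "linear (A2_adj C E)"
  proof (rule linearI)
    have "hadamard E (Y + Y') = hadamard E Y + hadamard E Y'" for Y Y'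
      by (simp add: hadamard_def vec_eq_iff distrib_left)
    then show "A2_adj C E (Y + Y') = A2_adj C E Y + A2_adj C E Y'" for Y Y'
      by (simp add: A2_adj_def matrix_add_ldistrib matrix_add_rdistrib)
    have "hadamard E (c *\<^sub>R Y) = c *\<^sub>R hadamard E Y" for c Y
      by (simp add: hadamard_def vec_eq_iff)
    then show "A2_adj C E (c *\<^sub>R Y) = c *\<^sub>R A2_adj C E Y" for c Y
      by (simp add: A2_adj_def matrix_scalar_ac scalar_matrix_assoc)
  qed
  then show ?thesis by (simp add: linear_conv_bounded_linear)
qed

text \<open>The chain rule for \<open>log_det\<close>; \<open>g\<close> is the adjoint of \<open>T'\<close> applied to the inverse \<open>R\<close> of \<open>T x\<close>.\<close>

lemma gradient_neg_log_det:
  assumes S: "subspace S" "x \<in> S"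
    and T: "(T has_derivative T') (at x within S)" "T ` S \<subseteq> Collect hermitian"
    and R: "posdef (T x)" "posdef R" "T x ** R = mat 1"
    and g: "g \<in> S" "\<And>h. R \<bullet> T' h = g \<bullet> h"
  shows "gradient_on S (\<lambda>x. - log_det (T x)) x = - g"
proof (rule gradient_on_eqI[OF S])
  show "- g \<in> S" using S g(1) by (simp add: subspace_neg)
  have "(log_det has_derivative (\<lambda>H. R \<bullet> H)) (at (T x) within T ` S)"
    using log_det_has_derivative[OF R] T(2) by (rule has_derivative_subset)
  from has_derivative_minus[OF has_derivative_in_compose[OF T(1) this]]
  show "((\<lambda>x. - log_det (T x)) has_derivative (\<lambda>h. - g \<bullet> h)) (at x within S)"
    by (simp add: g(2))
qed

section \<open>AMA as a proximal gradient step\<close>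

theorem mainTheorem4:
  fixes A :: "complex^'n^'n" and C :: "complex^'n^'p" and E G :: "complex^'p^'p"
    and \<gamma> \<rho> L :: real
    and D :: "((complex^'n^'n) \<times> (complex^'p^'p)) set"
    and Z Y1 :: "complex^'n^'n" and Y2 :: "complex^'p^'p"
  assumes "hurwitz A"
    and "hermitian G"
    and "transpose E = E"
    and "\<forall>i j. E $ i $ j = 0 \<or> E $ i $ j = 1"
    and "\<forall>i j. E $ i $ j = 0 \<longrightarrow> G $ i $ j = 0"
    and "\<gamma> > 0"
    and "convex D" and "D \<noteq> {}"
    and "D \<subseteq> {(V1, V2). hermitian V1 \<and> hermitian V2 \<and> posdef (A_adj A C E V1 V2)}"
    and "L > 0"
    and "L-lipschitz_on D
           (gradient_on (Collect hermitian \<times> Collect hermitian)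
             (\<lambda>(V1, V2). dual_objective A C E G V1 V2))"
    and "\<rho> = 1 / L"
    and "hermitian Z" and "hermitian Y1" and "hermitian Y2"
    and "posdef (A_adj A C E Y1 Y2)"
  shows "(\<exists>X' Z' Y1' Y2'. ama_step A C E G \<gamma> \<rho> Z Y1 Y2 X' Z' Y1' Y2')
    \<and> (\<forall>Y1' Y2'. (\<exists>X' Z'. ama_step A C E G \<gamma> \<rho> Z Y1 Y2 X' Z' Y1' Y2') \<longleftrightarrow>
           prox_grad_step (Collect hermitian) (\<lambda>V1. - log_det (A_adj A C E V1 Y2))
             (spectral_ball_indicator \<gamma>) L Y1 Y1' \<and>
           prox_grad_step (Collect hermitian) (\<lambda>V2. - log_det (A_adj A C E Y1 V2))
             (\<lambda>V2. ereal (G \<bullet> V2)) L Y2 Y2')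
    \<and> (\<forall>Y1' Y2'. (\<exists>X' Z'. ama_step A C E G \<gamma> \<rho> Z Y1 Y2 X' Z' Y1' Y2') \<longleftrightarrow>
           prox_grad_step (Collect hermitian \<times> Collect hermitian)
             (\<lambda>(V1, V2). - log_det (A_adj A C E V1 V2))
             (\<lambda>(V1, V2). ereal (G \<bullet> V2) + spectral_ball_indicator \<gamma> V1)
             L (Y1, Y2) (Y1', Y2'))"
proof -
  let ?H1 = "Collect hermitian :: (complex^'n^'n) set"
  let ?H2 = "Collect hermitian :: (complex^'p^'p) set"
  note E = assms(3,4) and L = \<open>L > 0\<close> and Y = \<open>hermitian Y1\<close> \<open>hermitian Y2\<close>
  have \<rho>: "\<rho> > 0" "L * \<rho> = 1" using assms(10,12) by simp_all
  define W where "W = A_adj A C E Y1 Y2"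
  have W: "posdef W" using assms(16) by (simp add: W_def)
  obtain X where X: "posdef X" "W ** X = mat 1" using posdef_inverse[OF W] by blast
  then have Xh: "hermitian X" by (simp add: posdef_def)
  define B1 where "B1 = A1 A X"
  define B2 where "B2 = A2 C E X"
  have B: "hermitian B1" "hermitian B2"
    unfolding B1_def B2_def by (intro hermitian_A1 hermitian_A2 E Xh)+
  obtain P T where PT: "hermitian P" "hermitian T" "Y1 + \<rho> *\<^sub>R B1 = P + T"
      "spectral_norm P \<le> \<gamma>" "P \<bullet> T = \<gamma> * nuclear_norm T"
    using spectral_ball_decomposition[of "Y1 + \<rho> *\<^sub>R B1" \<gamma>] assms(6) Y B
    by (auto simp: hermitian_add hermitian_scaleR)
  define Z0 where "Z0 = - (1 / \<rho>) *\<^sub>R T"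
  define Q where "Q = Y2 + \<rho> *\<^sub>R (B2 - G)"
  have Q: "hermitian Q"
    unfolding Q_def by (intro hermitian_add hermitian_scaleR hermitian_diff Y B assms(2))
  have P: "P = Y1 + \<rho> *\<^sub>R (B1 + Z0)"
    using PT(3) \<rho>(1) by (simp add: Z0_def algebra_simps)

  have "is_unique_arg_min (\<lambda>X. aug_lagrangian A C E G \<gamma> 0 X Z Y1 Y2) posdef X"
  proof -
    define c where "c = \<gamma> * nuclear_norm Z + Y1 \<bullet> Z - Y2 \<bullet> G"
    have "aug_lagrangian A C E G \<gamma> 0 V Z Y1 Y2 = (- log_det V + W \<bullet> V) + c" for V
      using inner_A1[of A V Y1] inner_A2[OF E(2), of C V Y2]
      by (simp add: aug_lagrangian_def c_def W_def A_adj_def inner_add_left inner_add_right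
          inner_diff_right inner_commute)
    then show ?thesis
      using log_det_minimizer[OF W X]
      by (simp add: is_unique_arg_min_def is_arg_min_linorder)
  qed
  moreover have "is_unique_arg_min (\<lambda>W. aug_lagrangian A C E G \<gamma> \<rho> X W Y1 Y2) hermitian Z0"
    using nuclear_norm_prox[OF \<rho>(1) PT(3,2,4,5),
        of "- log_det X + Y2 \<bullet> (A2 C E X - G) + \<rho> / 2 * (norm (A2 C E X - G))\<^sup>2"]
    by (simp add: aug_lagrangian_def Z0_def B1_def algebra_simps)
  ultimately have ama: "ama_step A C E G \<gamma> \<rho> Z Y1 Y2 X' Z' Y1' Y2' \<longleftrightarrow>
      X' = X \<and> Z' = Z0 \<and> Y1' = P \<and> Y2' = Q" for X' Z' Y1' Y2'
    unfolding ama_step_def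
    by (auto simp: is_unique_arg_min_iff P Q_def B1_def B2_def)

  have dT: "((\<lambda>V. A_adj A C E (fst V) (snd V)) has_derivative
      (\<lambda>H. A1_adj A (fst H) + A2_adj C E (snd H))) (at (Y1, Y2) within ?H1 \<times> ?H2)"
    unfolding A_adj_def
    by (intro has_derivative_add bounded_linear.has_derivative[OF bounded_linear_A1_adj]
        bounded_linear.has_derivative[OF bounded_linear_A2_adj] has_derivative_fst has_derivative_snd
        has_derivative_ident)
  have dT1: "((\<lambda>V. A_adj A C E V Y2) has_derivative A1_adj A) (at Y1 within ?H1)"
    unfolding A_adj_def using bounded_linear_imp_has_derivative[OF bounded_linear_A1_adj]
    by (auto intro!: derivative_eq_intros)
  have dT2: "((\<lambda>V. A_adj A C E Y1 V) has_derivative A2_adj C E) (at Y2 within ?H2)"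
    unfolding A_adj_def using bounded_linear_imp_has_derivative[OF bounded_linear_A2_adj]
    by (auto intro!: derivative_eq_intros)
  have adj: "X \<bullet> A1_adj A H1 = B1 \<bullet> H1" "X \<bullet> A2_adj C E H2 = B2 \<bullet> H2" for H1 H2
    by (simp_all add: B1_def B2_def inner_A1 inner_A2[OF E(2)])
  have grad1: "gradient_on ?H1 (\<lambda>V1. - log_det (A_adj A C E V1 Y2)) Y1 = - B1"
    by (rule gradient_neg_log_det[OF subspace_hermitian _ dT1 _ _ X(1)])
      (use W X Y B in \<open>auto simp: adj hermitian_A_adj[OF E] W_def\<close>)
  have grad2: "gradient_on ?H2 (\<lambda>V2. - log_det (A_adj A C E Y1 V2)) Y2 = - B2"
    by (rule gradient_neg_log_det[OF subspace_hermitian _ dT2 _ _ X(1)])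
      (use W X Y B in \<open>auto simp: adj hermitian_A_adj[OF E] W_def\<close>)
  have grad: "gradient_on (?H1 \<times> ?H2) (\<lambda>(V1, V2). - log_det (A_adj A C E V1 V2)) (Y1, Y2)
      = - (B1, B2)"
    unfolding case_prod_beta
    by (rule gradient_neg_log_det[OF subspace_Times[OF subspace_hermitian subspace_hermitian] _ dT _ _ X(1)])
      (use W X Y B in \<open>auto simp: adj hermitian_A_adj[OF E] W_def inner_add_right\<close>)

  \<comment> \<open>The residuals that \<open>prox_grad_stepI\<close> requires to be subgradients: \<open>L *\<^sub>R T\<close> is
    normal to the spectral ball at \<open>P\<close>, and \<open>G\<close> is the gradient of the linear term.\<close>
  have LT: "L *\<^sub>R (Y1 - P) + B1 = L *\<^sub>R T"
  proof -
    have "L *\<^sub>R (Y1 + \<rho> *\<^sub>R B1) = L *\<^sub>R (P + T)" by (simp only: PT(3))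
    then show ?thesis using \<rho>(2) by (simp add: algebra_simps)
  qed
  have LG: "L *\<^sub>R (Y2 - Q) + B2 = G"
    using \<rho>(2) by (simp add: Q_def algebra_simps)
  have ball: "ereal ((L *\<^sub>R T) \<bullet> (V - P)) \<le> spectral_ball_indicator \<gamma> V" for V
  proof (cases "spectral_norm V \<le> \<gamma>")
    case True
    have "V \<bullet> T \<le> \<gamma> * nuclear_norm T"
      using abs_inner_le_spectral_nuclear[OF PT(2), of V]
        mult_right_mono[OF True nuclear_norm_nonneg[OF PT(2)]] by linarith
    then have "T \<bullet> (V - P) \<le> 0" using PT(5) by (simp add: inner_diff_right inner_commute)
    then show ?thesis using L True by (simp add: spectral_ball_indicator_def mult_le_0_iff)
  qed (simp add: spectral_ball_indicator_def)
  have "prox_grad_step ?H1 (\<lambda>V1. - log_det (A_adj A C E V1 Y2)) (spectral_ball_indicator \<gamma>) L Y1 P"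
    using PT ball by (intro prox_grad_stepI[OF L, of _ _ _ 0])
      (auto simp: grad1 LT spectral_ball_indicator_def[of _ P] zero_ereal_def)
  then have prox1: "prox_grad_step ?H1 (\<lambda>V1. - log_det (A_adj A C E V1 Y2))
      (spectral_ball_indicator \<gamma>) L Y1 Y1' \<longleftrightarrow> Y1' = P" for Y1'
    unfolding prox_grad_step_def by (rule is_unique_arg_min_iff)
  have "prox_grad_step ?H2 (\<lambda>V2. - log_det (A_adj A C E Y1 V2)) (\<lambda>V2. ereal (G \<bullet> V2)) L Y2 Q"
    using Q by (intro prox_grad_stepI[OF L, of _ _ _ "G \<bullet> Q"])
      (auto simp: grad2 LG inner_diff_right)
  then have prox2: "prox_grad_step ?H2 (\<lambda>V2. - log_det (A_adj A C E Y1 V2))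
      (\<lambda>V2. ereal (G \<bullet> V2)) L Y2 Y2' \<longleftrightarrow> Y2' = Q" for Y2'
    unfolding prox_grad_step_def by (rule is_unique_arg_min_iff)
  have "prox_grad_step (?H1 \<times> ?H2) (\<lambda>(V1, V2). - log_det (A_adj A C E V1 V2))
      (\<lambda>(V1, V2). ereal (G \<bullet> V2) + spectral_ball_indicator \<gamma> V1) L (Y1, Y2) (P, Q)"
  proof (rule prox_grad_stepI[OF L, where c = "G \<bullet> Q"])
    show "(P, Q) \<in> ?H1 \<times> ?H2" using PT Q by simp
    show "(case (P, Q) of (V1, V2) \<Rightarrow> ereal (G \<bullet> V2) + spectral_ball_indicator \<gamma> V1) = ereal (G \<bullet> Q)"
      using PT by (simp add: spectral_ball_indicator_def)
    fix V assume "V \<in> ?H1 \<times> ?H2"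
    obtain V1 V2 where V: "V = (V1, V2)" by (cases V)
    have "L *\<^sub>R ((Y1, Y2) - (P, Q)) - gradient_on (?H1 \<times> ?H2)
        (\<lambda>(V1, V2). - log_det (A_adj A C E V1 V2)) (Y1, Y2) = (L *\<^sub>R T, G)"
      unfolding grad using LT LG by simp
    moreover have "ereal (G \<bullet> V2) + ereal ((L *\<^sub>R T) \<bullet> (V1 - P))
        \<le> ereal (G \<bullet> V2) + spectral_ball_indicator \<gamma> V1"
      using ball by (intro add_mono) auto
    ultimately show "ereal (G \<bullet> Q + (L *\<^sub>R ((Y1, Y2) - (P, Q))
        - gradient_on (?H1 \<times> ?H2) (\<lambda>(V1, V2). - log_det (A_adj A C E V1 V2)) (Y1, Y2)) \<bullet> (V - (P, Q)))
      \<le> (case V of (V1, V2) \<Rightarrow> ereal (G \<bullet> V2) + spectral_ball_indicator \<gamma> V1)"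
      unfolding V by (simp add: inner_diff_right add_ac)
  qed
  then have prox: "prox_grad_step (?H1 \<times> ?H2) (\<lambda>(V1, V2). - log_det (A_adj A C E V1 V2))
      (\<lambda>(V1, V2). ereal (G \<bullet> V2) + spectral_ball_indicator \<gamma> V1) L (Y1, Y2) (Y1', Y2')
      \<longleftrightarrow> Y1' = P \<and> Y2' = Q" for Y1' Y2'
    unfolding prox_grad_step_def by (subst is_unique_arg_min_iff) auto

  show ?thesis unfolding ama prox1 prox2 prox by blast
qed

end
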